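(* Consider any $1\le l\le r\le n/2$ and any fixed vector $a\in\mathbb R^n$. Suppose that the $H_{ij}$ ($1\le i,j\le n$) are independent with $H_{ij}\sim\mathcal N(0,\sigma_{ij}^2)$ and $\sigma_{ij}^2\ge\sigma_{\min}^2$, and assume that $4\sigma_{\min}\sqrt n\le|\lambda_l^\star|$ and $\sigma_{\min}\le\Delta_l^\star$. (1) There exist constants $c_0,c_1>0$ such that $$\inf_{\widehat u_l}\ \sup_{A\in\mathcal M_0(M^\star)}\mathbb E\Big[\min\|\widehat u_l\pm u_l(A)\|_2\Big]\ge c_0\frac{\sigma_{\min}}{\Delta_l^\star},$$ $$\inf_{\widehat u_{a,l}}\ \sup_{A\in\mathcal M_0(M^\star)}\mathbb E\Big[\min|\widehat u_{a,l}\pm a^\top u_l(A)|\Big]\ge c_1\left\{|a^\top u_l^\star|\frac{\sigma_{\min}^2}{(\Delta_l^\star)^2}+\sigma_{\min}\max_{k:k\ne l}\frac{|a^\top u_k^\star|}{|\lambda_l^\star-\lambda_k^\star|}\right\}.$$ (2) There exists a constant $c_2>0$ such that $$\inf_{\widehat u_{a,l}}\ \sup_{A\in\mathcal M_1(M^\star)}\mathbb E\Big[\min|\widehat u_{a,l}\pm a^\top u_l(A)|\Big]\ge c_2\frac{\sigma_{\min}\|a-(a^\top u_l^\star)u_l^\star\|_2}{|\lambda_l^\star|}.$$ (3) There exists a constant $c_3>0$ such that $$\inf_{\widehat u_l}\ \sup_{A\in\mathcal M_2(M^\star)}\mathbb E\Big[\min\|\widehat u_l\pm u_l(A)\|_2\Big]\ge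 c_3\frac{\sigma_{\min}\sqrt n}{|\lambda_l^\star|}.$$ Here the infimum over $\widehat u_l$ is over all estimators of the $l$th eigenvector and the infimum over $\widehat u_{a,l}$ is over all estimators of the linear form of the $l$th eigenvector, based on the observed matrix $M=A+H$, and $\mathbb E$ is taken with respect to $M=A+H$.
   Context: $M^\star=\sum_{l=1}^r\lambda_l^\star u_l^\star u_l^{\star\top}\in\mathbb R^{n\times n}$ is a symmetric rank-$r$ matrix with nonzero eigenvalues $\lambda_1^\star\ge\dots\ge\lambda_r^\star$ and orthonormal eigenvectors $u_1^\star,\dots,u_r^\star$. The eigen-gap is $\Delta_l^\star=\min_{1\le k\le r,k\ne l}|\lambda_l^\star-\lambda_k^\star|$ if $r>1$ and $\Delta_l^\star=\infty$ if $r=1$ (in which case $1/\Delta_l^\star$ and the maximum over $k\ne l$ are read as $0$). $\mathbb S^n$ is the set of symmetric $n\times n$ real matrices. For $A\in\mathbb S^n$ of rank $r$, $\lambda_i(A)$ is the $i$th largest of its $r$ nonzero eigenvalues and $u_i(A)$ the associated unit eigenvector. Define $$\mathcal M_0(M^\star)=\{A\in\mathbb S^n:\mathrm{rank}(A)=r,\ \lambda_i(A)=\lambda_i^\star\ (1\le i\le r),\ \|A-M^\star\|_{\mathrm F}\le\sigma_{\min}/2\},$$ $$\mathcal M_1(M^\star)=\{A\in\mathbb S^n:\mathrm{rank}(A)=r,\ \lambda_i(A)=\lambda_i^\star\ (1\le i\le r),\ \|u_l(A)-u_l^\star\|_2\le\tfrac{\sigma_{\min}}{4|\lambda_l^\star|}\},$$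 $$\mathcal M_2(M^\star)=\{A\in\mathbb S^n:\mathrm{rank}(A)=r,\ \lambda_i(A)=\lambda_i^\star\ (1\le i\le r),\ \|u_l(A)-u_l^\star\|_2\le c_4\tfrac{\sigma_{\min}\sqrt n}{|\lambda_l^\star|}\},$$ where $c_4>0$ is some sufficiently large constant. All constants are universal. Notation: $\min\|x\pm y\|_2=\min\{\|x-y\|_2,\|x+y\|_2\}$ and $\min|b\pm c|=\min\{|b-c|,|b+c|\}$. *)

theory Defs
  imports
    "HOL-Probability.Probability"
    "Jordan_Normal_Form.Char_Poly"
    "Jordan_Normal_Form.DL_Rank"
begin

unbundle no inner_syntax and no vec_syntax
hide_type (open) Finite_Cartesian_Product.vec
hide_const (open) Finite_Cartesian_Product.mat

text \<open>
  The dimension \<open>n\<close> is quantified inside the theorem because the constants must not depend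
  on it, so carrier-based matrices and vectors are used. Coordinates run over
  \<open>{..<n}\<close>, eigenpairs over \<open>{1..r}\<close>.
\<close>

definition norm2 :: "real vec \<Rightarrow> real" where
  "norm2 x = sqrt (x \<bullet> x)"

definition frob_norm :: "real mat \<Rightarrow> real" where
  "frob_norm A = sqrt (\<Sum>i<dim_row A. \<Sum>j<dim_col A. (A $$ (i, j))\<^sup>2)"

definition min_pm_vec :: "real vec \<Rightarrow> real vec \<Rightarrow> real" where
  "min_pm_vec x y = min (norm2 (x - y)) (norm2 (x + y))"

definition min_pm :: "real \<Rightarrow> real \<Rightarrow> real" where
  "min_pm b c = min \<bar>b - c\<bar> \<bar>b + c\<bar>"


subsection \<open>Eigenvalues and eigenvectors of symmetric matrices\<close>

definition nz_eigenvalues :: "real mat \<Rightarrow> real list" where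
  "nz_eigenvalues A = rev (sorted_list_of_multiset (filter_mset (\<lambda>x. x \<noteq> 0) (proots (char_poly A))))"

definition nth_eigenvalue :: "nat \<Rightarrow> real mat \<Rightarrow> real" where
  "nth_eigenvalue i A = nz_eigenvalues A ! (i - 1)"

text \<open>
  For a simple eigenvalue the unit eigenvector is determined up to its sign. The choice
  operator picks one of the two; every use below is invariant under a change of sign.
\<close>

definition nth_eigenvector :: "nat \<Rightarrow> real mat \<Rightarrow> real vec" where
  "nth_eigenvector i A = (SOME v. eigenvector A v (nth_eigenvalue i A) \<and> norm2 v = 1)"


subsection \<open>The true matrix\<close>

definition eigenpairs :: "nat \<Rightarrow> nat \<Rightarrow> (nat \<Rightarrow> real) \<Rightarrow> (nat \<Rightarrow> real vec) \<Rightarrow> bool" where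
  "eigenpairs n r lam u \<longleftrightarrow>
     (\<forall>k\<in>{1..r}. lam k \<noteq> 0) \<and>
     (\<forall>j\<in>{1..r}. \<forall>k\<in>{1..r}. j \<le> k \<longrightarrow> lam k \<le> lam j) \<and>
     (\<forall>k\<in>{1..r}. u k \<in> carrier_vec n) \<and>
     (\<forall>j\<in>{1..r}. \<forall>k\<in>{1..r}. u j \<bullet> u k = (if j = k then 1 else 0))"

definition spectral_mat :: "nat \<Rightarrow> nat \<Rightarrow> (nat \<Rightarrow> real) \<Rightarrow> (nat \<Rightarrow> real vec) \<Rightarrow> real mat" where
  "spectral_mat n r lam u = mat n n (\<lambda>(i, j). \<Sum>k = 1..r. lam k * u k $ i * u k $ j)"

text \<open>
  In \<^typ>\<open>ennreal\<close> the infimum of the empty set is \<open>\<infinity>\<close>, division by \<open>\<infinity>\<close> gives \<open>0\<close>, and the supremum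
  of the empty set is \<open>0\<close>: exactly the conventions needed for \<open>r = 1\<close>.
\<close>

definition eigengap :: "nat \<Rightarrow> (nat \<Rightarrow> real) \<Rightarrow> nat \<Rightarrow> ennreal" where
  "eigengap r lam l = (INF k\<in>{1..r} - {l}. ennreal \<bar>lam l - lam k\<bar>)"


subsection \<open>Parameter classes\<close>

definition isospectral :: "nat \<Rightarrow> nat \<Rightarrow> (nat \<Rightarrow> real) \<Rightarrow> real mat set" where
  "isospectral n r lam =
     {A \<in> carrier_mat n n. transpose_mat A = A \<and> vec_space.rank n A = r \<and>
        (\<forall>i\<in>{1..r}. nth_eigenvalue i A = lam i)}"

definition M0 :: "nat \<Rightarrow> nat \<Rightarrow> (nat \<Rightarrow> real) \<Rightarrow> (nat \<Rightarrow> real vec) \<Rightarrow> real \<Rightarrow> real mat set" where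
  "M0 n r lam u smin =
     {A \<in> isospectral n r lam. frob_norm (A - spectral_mat n r lam u) \<le> smin / 2}"

text \<open>The distance to \<open>u l\<close> is taken up to the sign ambiguity of the eigenvector.\<close>

definition M1 :: "nat \<Rightarrow> nat \<Rightarrow> (nat \<Rightarrow> real) \<Rightarrow> (nat \<Rightarrow> real vec) \<Rightarrow> nat \<Rightarrow> real \<Rightarrow> real mat set" where
  "M1 n r lam u l smin =
     {A \<in> isospectral n r lam. min_pm_vec (nth_eigenvector l A) (u l) \<le> smin / (4 * \<bar>lam l\<bar>)}"

definition M2 ::
  "real \<Rightarrow> nat \<Rightarrow> nat \<Rightarrow> (nat \<Rightarrow> real) \<Rightarrow> (nat \<Rightarrow> real vec) \<Rightarrow> nat \<Rightarrow> real \<Rightarrow> real mat set" where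
  "M2 c4 n r lam u l smin =
     {A \<in> isospectral n r lam.
        min_pm_vec (nth_eigenvector l A) (u l) \<le> c4 * (smin * sqrt (real n) / \<bar>lam l\<bar>)}"


subsection \<open>Noise, estimators and risk\<close>

text \<open>\<^const>\<open>normal_density\<close> is not a density for standard deviation \<open>0\<close>, where N(0,0) is a point mass.\<close>

definition centered_normal :: "real \<Rightarrow> real measure" where
  "centered_normal s =
     (if s = 0 then return borel 0 else density lborel (\<lambda>x. ennreal (normal_density 0 s x)))"

text \<open>Joint law of the independent entries \<open>H\<^sub>i\<^sub>j \<sim> N(0, (sd i j)\<^sup>2)\<close>; the noise matrix is \<open>mat n n h\<close>.\<close>

definition noise_law :: "nat \<Rightarrow> (nat \<Rightarrow> nat \<Rightarrow> real) \<Rightarrow> (nat \<times> nat \<Rightarrow> real) measure" where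
  "noise_law n sd = (\<Pi>\<^sub>M (i, j)\<in>{..<n} \<times> {..<n}. centered_normal (sd i j))"

text \<open>Estimators are the Borel functions of the \<open>n\<^sup>2\<close> entries of the observed matrix.\<close>

definition entry_space :: "nat \<Rightarrow> (nat \<times> nat \<Rightarrow> real) measure" where
  "entry_space n = (\<Pi>\<^sub>M ij\<in>{..<n} \<times> {..<n}. borel)"

definition scalar_estimators :: "nat \<Rightarrow> (real mat \<Rightarrow> real) set" where
  "scalar_estimators n = {f. (\<lambda>h. f (mat n n h)) \<in> borel_measurable (entry_space n)}"

definition vec_estimators :: "nat \<Rightarrow> (real mat \<Rightarrow> real vec) set" where
  "vec_estimators n =
     {f. (\<forall>A\<in>carrier_mat n n. f A \<in> carrier_vec n) \<and>
         (\<forall>i<n. (\<lambda>A. f A $ i) \<in> scalar_estimators n)}"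

definition vec_risk ::
  "nat \<Rightarrow> (nat \<Rightarrow> nat \<Rightarrow> real) \<Rightarrow> nat \<Rightarrow> (real mat \<Rightarrow> real vec) \<Rightarrow> real mat \<Rightarrow> ennreal" where
  "vec_risk n sd l f A =
     (\<integral>\<^sup>+ h. ennreal (min_pm_vec (f (A + mat n n h)) (nth_eigenvector l A)) \<partial>noise_law n sd)"

definition lin_risk ::
  "nat \<Rightarrow> (nat \<Rightarrow> nat \<Rightarrow> real) \<Rightarrow> nat \<Rightarrow> real vec \<Rightarrow> (real mat \<Rightarrow> real) \<Rightarrow> real mat \<Rightarrow> ennreal" where
  "lin_risk n sd l a f A =
     (\<integral>\<^sup>+ h. ennreal (min_pm (f (A + mat n n h)) (a \<bullet> nth_eigenvector l A)) \<partial>noise_law n sd)"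

definition vec_minimax ::
  "nat \<Rightarrow> (nat \<Rightarrow> nat \<Rightarrow> real) \<Rightarrow> nat \<Rightarrow> real mat set \<Rightarrow> ennreal" where
  "vec_minimax n sd l \<A> = (INF f\<in>vec_estimators n. SUP A\<in>\<A>. vec_risk n sd l f A)"

definition lin_minimax ::
  "nat \<Rightarrow> (nat \<Rightarrow> nat \<Rightarrow> real) \<Rightarrow> nat \<Rightarrow> real vec \<Rightarrow> real mat set \<Rightarrow> ennreal" where
  "lin_minimax n sd l a \<A> = (INF f\<in>scalar_estimators n. SUP A\<in>\<A>. lin_risk n sd l a f A)"


subsection \<open>Standing assumptions\<close>

definition setting ::
  "nat \<Rightarrow> nat \<Rightarrow> nat \<Rightarrow> (nat \<Rightarrow> real) \<Rightarrow> (nat \<Rightarrow> real vec) \<Rightarrow> (nat \<Rightarrow> nat \<Rightarrow> real) \<Rightarrow> real \<Rightarrow> bool" where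
  "setting n r l lam u sd smin \<longleftrightarrow>
     1 \<le> l \<and> l \<le> r \<and> real r \<le> real n / 2 \<and>
     eigenpairs n r lam u \<and>
     0 \<le> smin \<and> (\<forall>i<n. \<forall>j<n. (sd i j)\<^sup>2 \<ge> smin\<^sup>2) \<and>
     4 * smin * sqrt (real n) \<le> \<bar>lam l\<bar> \<and>
     ennreal smin \<le> eigengap r lam l"

end

theory Submission
  imports Defs
begin

text \<open>
  All four bounds come from families of matrices with the prescribed spectrum that the noise makes
  indistinguishable although their \<open>l\<close>-th eigenvectors differ. If two signals have Frobenius distance at
  most \<open>smin / 2\<close>, the Gaussian laws of the observations overlap in mass at least one half
  (\<open>likelihood_overlap\<close>): the Hellinger affinity of the two laws is an explicit product of
  one-dimensional integrals. Hence an estimator errs, for one of the two signals, by a constant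
  fraction of the separation of the targets (\<open>two_point_risk_bound\<close>).

  The first two classes use two-point families. The eigenvector \<open>u l\<close> is rotated by a small angle in
  the plane spanned by \<open>u l\<close> and a second vector of an eigenbasis. The plane itself is fixed, so the matrix
  only moves by the sine of the angle times the difference \<open>g\<close> of the two eigenvalues, and a sine of order
  \<open>smin / g\<close> goes unnoticed. The eigenvector then moves by that order, and a linear form of it
  changes by a first-order term, its value on the second vector times \<open>smin / g\<close>, and by a
  second-order term, its own value times \<open>(smin / g)\<^sup>2\<close>. The two terms may cancel for one direction of the
  rotation, but not for both (\<open>three_angles\<close>). For the class of matrices close to the true one, the
  second vector is another \<open>u k\<close>, with \<open>g\<close> the gap between \<open>lam l\<close> and \<open>lam k\<close>. For the class that
  only constrains the \<open>l\<close>-th eigenvector, the remaining eigenvectors are chosen such that the component of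
  \<open>a\<close> orthogonal to \<open>u l\<close> lies in the kernel; it serves as the second vector, with \<open>g = \<bar>lam l\<bar>\<close>.

  For the factor \<open>sqrt n\<close> in the last bound, \<open>u l\<close> is perturbed in all \<open>n - r \<ge> n / 2\<close> kernel
  directions at once, by \<open>smin / (8 * \<bar>lam l\<bar>)\<close> times a vector of signs. Changing one sign is a
  two-point problem as before, so each sign is guessed wrongly with constant probability, and the errors
  add up (\<open>hypercube_risk_bound\<close>, \<open>vec_minimax_M2\<close>). The global sign ambiguity of eigenvectors does no
  harm, since the large component along \<open>u l\<close> determines the global sign.
\<close>

section \<open>Distances up to sign\<close>

lemma norm2_eq_L2: "norm2 x = L2_set (\<lambda>i. x $ i) {..<dim_vec x}"
  unfolding norm2_def scalar_prod_def L2_set_def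
  by (simp add: power2_eq_square lessThan_atLeast0)

lemma norm2_nonneg [simp]: "0 \<le> norm2 x"
  by (simp add: norm2_eq_L2)

lemma norm2_power2: "(norm2 x)\<^sup>2 = x \<bullet> x"
  unfolding norm2_def by (rule real_sqrt_pow2) (auto simp: scalar_prod_def intro!: sum_nonneg)

lemma norm2_triangle:
  assumes "x \<in> carrier_vec n" "y \<in> carrier_vec n"
  shows "norm2 (x + y) \<le> norm2 x + norm2 y"
proof -
  have "norm2 (x + y) = L2_set (\<lambda>i. x $ i + y $ i) {..<n}"
    unfolding norm2_eq_L2 using assms by (intro L2_set_cong) auto
  also have "\<dots> \<le> norm2 x + norm2 y"
    unfolding norm2_eq_L2 using assms L2_set_triangle_ineq[of "\<lambda>i. x $ i" "\<lambda>i. y $ i" "{..<n}"] by auto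
  finally show ?thesis .
qed

lemma norm2_uminus:
  assumes "x \<in> carrier_vec n" shows "norm2 (- x) = norm2 x"
  unfolding norm2_def using assms by simp

lemma norm2_minus_commute:
  assumes "x \<in> carrier_vec n" "y \<in> carrier_vec n"
  shows "norm2 (x - y) = norm2 (y - x)"
proof -
  have "y - x = - (x - y)" using assms by (intro eq_vecI) auto
  then show ?thesis using assms norm2_uminus[of "x - y" n] by simp
qed

lemma norm2_triangle_minus:
  assumes "x \<in> carrier_vec n" "y \<in> carrier_vec n" "z \<in> carrier_vec n"
  shows "norm2 (x - z) \<le> norm2 (x - y) + norm2 (y - z)"
proof -
  have "x - z = (x - y) + (y - z)" using assms by (intro eq_vecI) auto
  then show ?thesis using assms norm2_triangle[of "x - y" n "y - z"] by simp
qed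

lemma norm2_diff_power2:
  assumes "x \<in> carrier_vec n" "y \<in> carrier_vec n"
  shows "(norm2 (x - y))\<^sup>2 = x \<bullet> x - 2 * (x \<bullet> y) + y \<bullet> y"
  using assms comm_scalar_prod[OF assms]
  by (simp add: norm2_power2 minus_scalar_prod_distrib[of _ n] scalar_prod_minus_distrib[of _ n])

lemma norm2_sum_power2:
  assumes "x \<in> carrier_vec n" "y \<in> carrier_vec n"
  shows "(norm2 (x + y))\<^sup>2 = x \<bullet> x + 2 * (x \<bullet> y) + y \<bullet> y"
  using assms comm_scalar_prod[OF assms]
  by (simp add: norm2_power2 add_scalar_prod_distrib[of _ n] scalar_prod_add_distrib[of _ n])

lemma min_pm_vec_eq:
  assumes "x \<in> carrier_vec n" "y \<in> carrier_vec n"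
  shows "min_pm_vec x y = min (norm2 (x - y)) (norm2 (x - (- y)))"
  unfolding min_pm_vec_def using assms by (simp add: minus_add_uminus_vec[of x n "- y"])

lemma min_pm_vec_nonneg: "0 \<le> min_pm_vec x y"
  by (simp add: min_pm_vec_def)

text \<open>
  Distances up to sign obey the triangle inequality because any two sign choices can be composed.
  This is what turns an estimator that is good for two hypotheses into a bound on their separation.
\<close>

lemma min_pm_vec_triangle:
  assumes "x \<in> carrier_vec n" "y \<in> carrier_vec n" "z \<in> carrier_vec n"
  shows "min_pm_vec x y \<le> min_pm_vec z x + min_pm_vec z y"
proof -
  have s: "norm2 (a + b) = norm2 (a - (- b))" "norm2 ((-a) - b) = norm2 (a - (-b))"
     "norm2 ((-a) - (-b)) = norm2 (a - b)"
    if "a \<in> carrier_vec n" "b \<in> carrier_vec n" for a b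
  proof -
    show "norm2 (a + b) = norm2 (a - (- b))" using that by (simp add: minus_add_uminus_vec[of a n "- b"])
    have "(-a) - b = - (a - (-b))" "(-a) - (-b) = - (a - b)" using that by (auto intro!: eq_vecI)
    then show "norm2 ((-a) - b) = norm2 (a - (-b))" "norm2 ((-a) - (-b)) = norm2 (a - b)"
      using that norm2_uminus[of "a - (-b)" n] norm2_uminus[of "a - b" n] by auto
  qed
  have T: "norm2 (p - q) \<le> norm2 (z - p) + norm2 (z - q)" if "p \<in> carrier_vec n" "q \<in> carrier_vec n" for p q
    using norm2_triangle_minus[OF that(1) assms(3) that(2)] norm2_minus_commute[OF that(1) assms(3)] by simp
  show ?thesis
    unfolding min_pm_vec_eq[OF assms(1,2)] min_pm_vec_eq[OF assms(3,1)] min_pm_vec_eq[OF assms(3,2)]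
    using T[of x y] T[of x "- y"] T[of "- x" y] T[of "- x" "- y"] assms s[of x y]
    by (auto simp: min_def)
qed

lemma min_pm_vec_uminus_left:
  assumes "x \<in> carrier_vec n" "y \<in> carrier_vec n"
  shows "min_pm_vec (- x) y = min_pm_vec x y"
proof -
  have "- x - y = - (x + y)" "- x + y = - (x - y)" using assms by (auto intro!: eq_vecI)
  then show ?thesis using assms norm2_uminus[of "x + y" n] norm2_uminus[of "x - y" n]
    by (simp add: min_pm_vec_def min.commute)
qed

lemma min_pm_vec_commute:
  assumes "x \<in> carrier_vec n" "y \<in> carrier_vec n"
  shows "min_pm_vec x y = min_pm_vec y x"
  using norm2_minus_commute[OF assms] comm_add_vec[OF assms] by (simp add: min_pm_vec_def)

lemma min_pm_vec_uminus_right: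
  assumes "x \<in> carrier_vec n" "y \<in> carrier_vec n"
  shows "min_pm_vec x (- y) = min_pm_vec x y"
  using min_pm_vec_commute[of x n "- y"] min_pm_vec_commute[of x n y] min_pm_vec_uminus_left[of y n x] assms
  by simp

text \<open>
  For unit vectors at angle \<open>\<theta>\<close> the chord length is \<open>2 * sin (\<theta> / 2)\<close>, which lies between
  \<open>sin \<theta>\<close> and \<open>sqrt 2 * sin \<theta>\<close> when \<open>\<theta>\<close> is at most a right angle. This lemma and the next one
  are the two halves of that comparison, with \<open>c\<close> and \<open>s\<close> in place of cosine and sine.
\<close>

lemma min_pm_vec_ge_sin:
  assumes "x \<in> carrier_vec n" "y \<in> carrier_vec n" "x \<bullet> x = 1" "y \<bullet> y = 1" "x \<bullet> y = c"
    and "0 \<le> c" "c\<^sup>2 + s\<^sup>2 = 1"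
  shows "\<bar>s\<bar> \<le> min_pm_vec x y"
proof -
  have "c\<^sup>2 \<le> 1\<^sup>2" using assms(7) zero_le_power2[of s] unfolding one_power2 by linarith
  then have c1: "c \<le> 1" by (rule power2_le_imp_le) simp
  have s2: "\<bar>s\<bar>\<^sup>2 = (1 - c) * (1 + c)" using assms(7) by (simp add: power2_eq_square algebra_simps)
  also have "\<dots> \<le> (1 - c) * 2" using c1 by (intro mult_left_mono) auto
  finally have "\<bar>s\<bar>\<^sup>2 \<le> 2 - 2 * c" by simp
  then have "\<bar>s\<bar>\<^sup>2 \<le> (norm2 (x - y))\<^sup>2" "\<bar>s\<bar>\<^sup>2 \<le> (norm2 (x + y))\<^sup>2"
    using assms by (simp_all add: norm2_diff_power2[OF assms(1,2)] norm2_sum_power2[OF assms(1,2)])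
  then show ?thesis unfolding min_pm_vec_def by (auto intro: power2_le_imp_le)
qed

lemma min_pm_vec_le_sin:
  assumes "x \<in> carrier_vec n" "y \<in> carrier_vec n" "x \<bullet> x = 1" "y \<bullet> y = 1" "x \<bullet> y = c"
    and "0 \<le> c" "c\<^sup>2 + s\<^sup>2 = 1"
  shows "min_pm_vec x y \<le> sqrt 2 * \<bar>s\<bar>"
proof -
  have "c\<^sup>2 \<le> 1\<^sup>2" using assms(7) zero_le_power2[of s] unfolding one_power2 by linarith
  then have c1: "c \<le> 1" by (rule power2_le_imp_le) simp
  have "1 - c \<le> (1 - c) * (1 + c)" using c1 assms(6) mult_left_mono[of 1 "1 + c" "1 - c"] by simp
  also have "\<dots> = s\<^sup>2" using assms(7) by (simp add: power2_eq_square algebra_simps)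
  finally have "2 - 2 * c \<le> 2 * s\<^sup>2" by simp
  also have "2 - 2 * c = (norm2 (x - y))\<^sup>2" using assms by (simp add: norm2_diff_power2[OF assms(1,2)])
  finally have "(norm2 (x - y))\<^sup>2 \<le> (sqrt 2 * \<bar>s\<bar>)\<^sup>2" by (simp add: power_mult_distrib)
  then have "norm2 (x - y) \<le> sqrt 2 * \<bar>s\<bar>" by (rule power2_le_imp_le) simp
  then show ?thesis by (simp add: min_pm_vec_def)
qed

lemma min_pm_eq: "min_pm b c = \<bar>\<bar>b\<bar> - \<bar>c\<bar>\<bar>"
  unfolding min_pm_def by (auto simp: min_def abs_if)

lemma min_pm_triangle: "min_pm x y \<le> min_pm z x + min_pm z y"
  unfolding min_pm_eq by linarith

section \<open>Orthonormal families\<close>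

definition orthonormal :: "nat \<Rightarrow> nat \<Rightarrow> (nat \<Rightarrow> real vec) \<Rightarrow> bool" where
  "orthonormal n m e \<longleftrightarrow> (\<forall>k\<in>{1..m}. e k \<in> carrier_vec n) \<and>
     (\<forall>j\<in>{1..m}. \<forall>k\<in>{1..m}. e j \<bullet> e k = (if j = k then 1 else 0))"

lemma orthonormal_mono: "orthonormal n m e \<Longrightarrow> r \<le> m \<Longrightarrow> orthonormal n r e"
  unfolding orthonormal_def by auto

text \<open>
  Orthogonality to \<open>m < n\<close> vectors is an underdetermined homogeneous linear system.
\<close>

lemma exists_orthogonal_unit_vector:
  assumes "m < n" "\<And>k. k \<in> {1..m} \<Longrightarrow> e k \<in> carrier_vec n"
  shows "\<exists>x\<in>carrier_vec n. x \<bullet> x = 1 \<and> (\<forall>k\<in>{1..m}. e k \<bullet> (x :: real vec) = 0)"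
proof -
  \<comment> \<open>The rows of \<open>A\<close> are the \<open>m < n\<close> given vectors, padded by zero rows, so \<open>A\<close> is singular.\<close>
  define A where "A = mat n n (\<lambda>(i, j). if i < m then e (i + 1) $ j else 0)"
  have A: "A \<in> carrier_mat n n" unfolding A_def by simp
  have "A = mat\<^sub>r n n (\<lambda>i. if i = m then 0\<^sub>v n else row A i)"
    using assms(1) by (intro eq_matI) (auto simp: A_def)
  then have "det A = 0" using det_row_0[OF assms(1), of "row A"] A by auto
  then obtain v where v: "v \<in> carrier_vec n" "v \<noteq> 0\<^sub>v n" "A *\<^sub>v v = 0\<^sub>v n"
    using det_0_iff_vec_prod_zero_field[OF A] by auto
  have orth: "e k \<bullet> v = 0" if "k \<in> {1..m}" for k
  proof -
    have "(A *\<^sub>v v) $ (k - 1) = row A (k - 1) \<bullet> v"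
      using that A assms(1) by (intro index_mult_mat_vec) auto
    also have "row A (k - 1) = e k"
    proof -
      have "dim_vec (e k) = n" using assms(2)[OF that] by simp
      then show ?thesis using that assms(1) by (intro eq_vecI) (auto simp: A_def)
    qed
    finally have "e k \<bullet> v = 0\<^sub>v n $ (k - 1)" using v(3) by simp
    also have "\<dots> = 0" using that assms(1) by (intro index_zero_vec) auto
    finally show ?thesis .
  qed
  obtain i where i: "i < n" "v $ i \<noteq> 0" using v(1,2) by (auto simp: vec_eq_iff)
  have "0 < (\<Sum>i<n. v $ i * v $ i)" using i by (intro sum_pos2[of _ i]) (auto simp: not_square_less_zero zero_less_mult_iff linorder_neq_iff)
  then have pos: "0 < v \<bullet> v" using v(1) by (simp add: scalar_prod_def lessThan_atLeast0)
  define x where "x = (1 / sqrt (v \<bullet> v)) \<cdot>\<^sub>v v"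
  have "x \<bullet> x = (1 / sqrt (v \<bullet> v)) * ((1 / sqrt (v \<bullet> v)) * (v \<bullet> v))"
    unfolding x_def using v by simp
  also have "\<dots> = 1" using pos by (simp add: field_simps)
  finally have "x \<bullet> x = 1" .
  moreover have "e k \<bullet> x = 0" if "k \<in> {1..m}" for k
    unfolding x_def using orth[OF that] assms(2)[OF that] v by simp
  ultimately show ?thesis using v by (intro bexI[of _ x]) (auto simp: x_def)
qed

text \<open>
  As long as fewer than \<open>n\<close> vectors are present, some unit vector is orthogonal to all of them
  and can be appended.
\<close>

lemma orthonormal_extension:
  assumes "orthonormal n m u" "m \<le> n"
  shows "\<exists>e. orthonormal n n e \<and> (\<forall>k\<in>{1..m}. e k = u k)"
proof -
  have "\<exists>e. orthonormal n p e \<and> (\<forall>k\<in>{1..m}. e k = u k)" if "m \<le> p" "p \<le> n" for p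
    using that
  proof (induction p rule: dec_induct)
    case base then show ?case using assms by auto
  next
    case (step p)
    then obtain e where e: "orthonormal n p e" "\<forall>k\<in>{1..m}. e k = u k" by auto
    obtain x where x: "x \<in> carrier_vec n" "x \<bullet> x = 1" "\<forall>k\<in>{1..p}. e k \<bullet> x = 0"
      using exists_orthogonal_unit_vector[of p n e] e(1) step by (auto simp: orthonormal_def)
    have x': "x \<bullet> e k = 0" if "k \<in> {1..p}" for k
      using x that e(1) by (metis comm_scalar_prod orthonormal_def)
    have "orthonormal n (Suc p) (e(Suc p := x))"
      using e(1) x x' unfolding orthonormal_def by (auto simp: le_Suc_eq)
    then show ?case using e(2) step.hyps(1) by (intro exI[of _ "e(Suc p := x)"] conjI) (assumption, auto)
  qed
  then show ?thesis using assms(2) by auto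
qed

lemma orthonormal_permute:
  assumes "orthonormal n m e" "inj_on \<pi> {1..m}" "\<pi> ` {1..m} \<subseteq> {1..m}"
  shows "orthonormal n m (\<lambda>k. e (\<pi> k))"
  unfolding orthonormal_def
proof (intro conjI ballI)
  fix j assume j: "j \<in> {1..m}"
  then have pj: "\<pi> j \<in> {1..m}" using assms(3) by blast
  then show "e (\<pi> j) \<in> carrier_vec n" using assms(1) by (auto simp: orthonormal_def)
  fix k assume k: "k \<in> {1..m}"
  then have pk: "\<pi> k \<in> {1..m}" using assms(3) by blast
  have "(\<pi> j = \<pi> k) = (j = k)" using assms(2) j k by (rule inj_on_eq_iff)
  then show "e (\<pi> j) \<bullet> e (\<pi> k) = (if j = k then 1 else 0)"
    using assms(1) pj pk unfolding orthonormal_def by metis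
qed

text \<open>
  Places a prescribed orthonormal pair at prescribed positions of a basis, so that the index \<open>l\<close>
  keeps its meaning as position of the eigenvalue \<open>lam l\<close>.
\<close>

lemma orthonormal_basis_through_pair:
  assumes x: "x \<in> carrier_vec n" "x \<bullet> x = 1" and y: "y \<in> carrier_vec n" "y \<bullet> y = 1" and xy: "x \<bullet> y = 0"
    and lk: "l \<in> {1..n}" "k \<in> {1..n}" "1 < k" "l \<noteq> k"
  shows "\<exists>e. orthonormal n n e \<and> e l = x \<and> e k = y"
proof -
  have yx: "y \<bullet> x = 0" using xy x y comm_scalar_prod by metis
  have i: "j \<in> {1..2} \<longleftrightarrow> j = 1 \<or> j = 2" for j :: nat by auto
  have "orthonormal n 2 (\<lambda>j. if j = 1 then x else y)"
    unfolding orthonormal_def Ball_def i using x y xy yx by auto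
  moreover have "2 \<le> n" using lk by auto
  ultimately obtain f where f: "orthonormal n n f" "\<forall>j\<in>{1..2}. f j = (if j = 1 then x else y)"
    using orthonormal_extension by blast
  \<comment> \<open>The pair is extended in positions 1 and 2 and then moved to positions \<open>l\<close> and \<open>k\<close>.\<close>
  define \<pi> where "\<pi> = Transposition.transpose 2 k \<circ> Transposition.transpose 1 l"
  have perm: "\<pi> permutes {1..n}" unfolding \<pi>_def using lk
    by (intro permutes_compose permutes_swap_id) auto
  have "orthonormal n n (\<lambda>j. f (\<pi> j))"
    by (rule orthonormal_permute[OF f(1) permutes_inj_on[OF perm]]) (simp only: permutes_image[OF perm] order_refl)
  moreover have "\<pi> l = 1" "\<pi> k = 2" unfolding \<pi>_def using lk by (auto simp: Transposition.transpose_def)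
  ultimately show ?thesis using f(2) by (intro exI[of _ "\<lambda>j. f (\<pi> j)"]) simp
qed

definition basis_comb :: "nat \<Rightarrow> (nat \<Rightarrow> real vec) \<Rightarrow> (nat \<Rightarrow> real) \<Rightarrow> real vec" where
  "basis_comb n e f = vec n (\<lambda>i. \<Sum>k = 1..n. f k * e k $ i)"

lemma basis_comb_carrier [simp]: "basis_comb n e f \<in> carrier_vec n"
  by (simp add: basis_comb_def)

lemma basis_comb_scalar_prod:
  assumes "x \<in> carrier_vec n"
  shows "basis_comb n e f \<bullet> x = (\<Sum>k = 1..n. f k * (e k \<bullet> x))"
proof -
  have "basis_comb n e f \<bullet> x = (\<Sum>i<n. \<Sum>k = 1..n. f k * e k $ i * x $ i)"
    using assms by (simp add: basis_comb_def scalar_prod_def lessThan_atLeast0 sum_distrib_right)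
  also have "\<dots> = (\<Sum>k = 1..n. \<Sum>i<n. f k * e k $ i * x $ i)" by (rule sum.swap)
  finally show ?thesis
    using assms by (simp add: scalar_prod_def lessThan_atLeast0 sum_distrib_left mult.assoc)
qed

lemma basis_comb_coord:
  assumes e: "orthonormal n n e" and k: "k \<in> {1..n}"
  shows "basis_comb n e f \<bullet> e k = f k"
proof -
  have "e k \<in> carrier_vec n" using assms by (auto simp: orthonormal_def)
  then have "basis_comb n e f \<bullet> e k = (\<Sum>j = 1..n. f j * (e j \<bullet> e k))" by (rule basis_comb_scalar_prod)
  also have "\<dots> = (\<Sum>j = 1..n. if j = k then f j else 0)"
    using assms by (intro sum.cong refl) (auto simp: orthonormal_def)
  finally show ?thesis using k by simp
qed

lemma basis_comb_inner:
  assumes e: "orthonormal n n e"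
  shows "basis_comb n e f \<bullet> basis_comb n e g = (\<Sum>k = 1..n. f k * g k)"
proof -
  have "e k \<bullet> basis_comb n e g = g k" if "k \<in> {1..n}" for k
    using basis_comb_coord[OF e that, of g] comm_scalar_prod[of "e k" n "basis_comb n e g"] e that
    by (auto simp: orthonormal_def)
  then show ?thesis by (simp add: basis_comb_scalar_prod)
qed

text \<open>
  The residual of \<open>y\<close> after projection onto the basis has nonnegative squared norm.
\<close>

lemma bessel_inequality:
  assumes e: "orthonormal n n e" and y: "y \<in> carrier_vec n"
  shows "(\<Sum>k = 1..n. (y \<bullet> e k)\<^sup>2) \<le> (norm2 y)\<^sup>2"
proof -
  let ?f = "\<lambda>k. y \<bullet> e k" and ?p = "basis_comb n e (\<lambda>k. y \<bullet> e k)"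
  have "e k \<bullet> y = y \<bullet> e k" if "k \<in> {1..n}" for k
    using e that y by (intro comm_scalar_prod[of _ n]) (auto simp: orthonormal_def)
  then have "?p \<bullet> y = (\<Sum>k = 1..n. (?f k)\<^sup>2)"
    using y by (simp add: basis_comb_scalar_prod power2_eq_square)
  moreover have "?p \<bullet> ?p = (\<Sum>k = 1..n. (?f k)\<^sup>2)"
    using e by (simp add: basis_comb_inner power2_eq_square)
  moreover have "0 \<le> (norm2 (y - ?p))\<^sup>2" by simp
  ultimately show ?thesis
    using norm2_diff_power2[OF y, of ?p] y comm_scalar_prod[OF y, of ?p] by (simp add: norm2_power2)
qed

lemma coordinate_error_le:
  assumes e: "orthonormal n n e" and y: "y \<in> carrier_vec n"
  shows "(\<Sum>k = 1..n. (y \<bullet> e k - f k)\<^sup>2) \<le> (norm2 (y - basis_comb n e f))\<^sup>2"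
proof -
  have "(y - basis_comb n e f) \<bullet> e k = y \<bullet> e k - f k" if "k \<in> {1..n}" for k
    using basis_comb_coord[OF e that, of f] e that y
    by (subst minus_scalar_prod_distrib[of _ n]) (auto simp: orthonormal_def)
  then show ?thesis using bessel_inequality[OF e, of "y - basis_comb n e f"] y by simp
qed

section \<open>Spectra of symmetric matrices\<close>

lemma spectral_mat_carrier [simp]: "spectral_mat n r lam u \<in> carrier_mat n n"
  unfolding spectral_mat_def by simp

lemma spectral_mat_mult_vec:
  assumes "\<And>k. k \<in> {1..r} \<Longrightarrow> v k \<in> carrier_vec n" "x \<in> carrier_vec n" "i < n"
  shows "(spectral_mat n r lam v *\<^sub>v x) $ i = (\<Sum>k = 1..r. lam k * (v k \<bullet> x) * v k $ i)"
proof -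
  have "(spectral_mat n r lam v *\<^sub>v x) $ i = (\<Sum>j<n. (\<Sum>k = 1..r. lam k * v k $ i * v k $ j) * x $ j)"
    using assms by (simp add: spectral_mat_def scalar_prod_def lessThan_atLeast0)
  also have "\<dots> = (\<Sum>k = 1..r. \<Sum>j<n. lam k * v k $ i * v k $ j * x $ j)"
    unfolding sum_distrib_right by (rule sum.swap)
  also have "\<dots> = (\<Sum>k = 1..r. lam k * (v k \<bullet> x) * v k $ i)"
    using assms(2) by (intro sum.cong refl)
      (simp add: scalar_prod_def lessThan_atLeast0 sum_distrib_left sum_distrib_right ac_simps)
  finally show ?thesis .
qed

lemma scalar_prod_spectral_mat:
  assumes v: "orthonormal n r v" and x: "x \<in> carrier_vec n" and k: "k \<in> {1..r}"
  shows "v k \<bullet> (spectral_mat n r lam v *\<^sub>v x) = lam k * (v k \<bullet> x)"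
proof -
  have c: "v j \<in> carrier_vec n" if "j \<in> {1..r}" for j using v that by (auto simp: orthonormal_def)
  have "v k \<bullet> (spectral_mat n r lam v *\<^sub>v x)
      = (\<Sum>i<n. v k $ i * (\<Sum>j = 1..r. lam j * (v j \<bullet> x) * v j $ i))"
  proof -
    have "dim_vec (spectral_mat n r lam v *\<^sub>v x) = n" by (simp add: spectral_mat_def)
    then have "v k \<bullet> (spectral_mat n r lam v *\<^sub>v x) = (\<Sum>i<n. v k $ i * (spectral_mat n r lam v *\<^sub>v x) $ i)"
      by (simp add: scalar_prod_def lessThan_atLeast0)
    also have "\<dots> = (\<Sum>i<n. v k $ i * (\<Sum>j = 1..r. lam j * (v j \<bullet> x) * v j $ i))"
      using c x by (intro sum.cong refl) (subst spectral_mat_mult_vec, auto)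
    finally show ?thesis .
  qed
  also have "\<dots> = (\<Sum>j = 1..r. \<Sum>i<n. v k $ i * (lam j * (v j \<bullet> x) * v j $ i))"
    unfolding sum_distrib_left by (rule sum.swap)
  also have "\<dots> = (\<Sum>j = 1..r. lam j * (v j \<bullet> x) * (v k \<bullet> v j))"
  proof (intro sum.cong refl)
    fix j assume "j \<in> {1..r}"
    then have "dim_vec (v j) = n" using c by simp
    then show "(\<Sum>i<n. v k $ i * (lam j * (v j \<bullet> x) * v j $ i)) = lam j * (v j \<bullet> x) * (v k \<bullet> v j)"
      by (simp add: scalar_prod_def[of "v k"] lessThan_atLeast0 sum_distrib_left ac_simps)
  qed
  also have "\<dots> = (\<Sum>j = 1..r. if j = k then lam j * (v j \<bullet> x) else 0)"
    using v k by (intro sum.cong refl) (auto simp: orthonormal_def)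
  also have "\<dots> = lam k * (v k \<bullet> x)" using k by simp
  finally show ?thesis .
qed

lemma spectral_mat_eigenvector:
  assumes v: "orthonormal n r v" and l: "l \<in> {1..r}"
  shows "spectral_mat n r lam v *\<^sub>v v l = lam l \<cdot>\<^sub>v v l"
proof (intro eq_vecI)
  have c: "v j \<in> carrier_vec n" if "j \<in> {1..r}" for j using v that by (auto simp: orthonormal_def)
  fix i assume "i < dim_vec (lam l \<cdot>\<^sub>v v l)"
  then have i: "i < n" using c[OF l] by simp
  have "(spectral_mat n r lam v *\<^sub>v v l) $ i = (\<Sum>k = 1..r. lam k * (v k \<bullet> v l) * v k $ i)"
    by (rule spectral_mat_mult_vec) (use c l i in auto)
  also have "\<dots> = (\<Sum>k = 1..r. if k = l then lam k * v k $ i else 0)"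
    using v l by (intro sum.cong refl) (auto simp: orthonormal_def)
  finally show "(spectral_mat n r lam v *\<^sub>v v l) $ i = (lam l \<cdot>\<^sub>v v l) $ i"
    using l i c[OF l] by simp
next
  have "v l \<in> carrier_vec n" using v l by (auto simp: orthonormal_def)
  then show "dim_vec (spectral_mat n r lam v *\<^sub>v v l) = dim_vec (lam l \<cdot>\<^sub>v v l)"
    by (simp add: spectral_mat_def)
qed

text \<open>
  Taking inner products of the eigenvalue equation with \<open>v k\<close> kills every component of \<open>x\<close> whose
  eigenvalue differs from \<open>lam l\<close>; the image of the matrix lies in the span of the \<open>v k\<close>, so that, as
  \<open>lam l\<close> is nonzero, only the component along \<open>v l\<close> remains.
\<close>

lemma simple_eigenvector_unique:
  assumes v: "orthonormal n r v" and l: "l \<in> {1..r}"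
    and nz: "lam l \<noteq> 0" and simple: "\<forall>k\<in>{1..r} - {l}. lam k \<noteq> lam l"
    and x: "x \<in> carrier_vec n" "spectral_mat n r lam v *\<^sub>v x = lam l \<cdot>\<^sub>v x" "x \<bullet> x = 1"
  shows "x = v l \<or> x = - v l"
proof -
  have c: "v j \<in> carrier_vec n" if "j \<in> {1..r}" for j using v that by (auto simp: orthonormal_def)
  have z: "v k \<bullet> x = 0" if "k \<in> {1..r} - {l}" for k
  proof -
    have "lam k * (v k \<bullet> x) = lam l * (v k \<bullet> x)"
      using scalar_prod_spectral_mat[OF v x(1), of k lam] x that c[of k] by auto
    then show ?thesis using simple that by auto
  qed
  have xe: "x = (v l \<bullet> x) \<cdot>\<^sub>v v l"
  proof (intro eq_vecI)
    fix i assume "i < dim_vec ((v l \<bullet> x) \<cdot>\<^sub>v v l)"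
    then have i: "i < n" using c[OF l] by simp
    have "lam l * x $ i = (spectral_mat n r lam v *\<^sub>v x) $ i" using x i by simp
    also have "\<dots> = (\<Sum>k = 1..r. lam k * (v k \<bullet> x) * v k $ i)"
      by (rule spectral_mat_mult_vec) (use c x i in auto)
    also have "\<dots> = (\<Sum>k = 1..r. if k = l then lam l * (v l \<bullet> x) * v l $ i else 0)"
      using z by (intro sum.cong refl) auto
    finally show "x $ i = ((v l \<bullet> x) \<cdot>\<^sub>v v l) $ i" using l i nz c[OF l] by simp
  qed (use x c[OF l] in auto)
  have "1 = ((v l \<bullet> x) \<cdot>\<^sub>v v l) \<bullet> ((v l \<bullet> x) \<cdot>\<^sub>v v l)" using x(3) xe by simp
  also have "\<dots> = (v l \<bullet> x)\<^sup>2"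
    using c[OF l] v l by (simp add: power2_eq_square orthonormal_def)
  finally have "v l \<bullet> x = 1 \<or> v l \<bullet> x = -1" by (metis power2_eq_1_iff)
  then show ?thesis
  proof
    assume "v l \<bullet> x = 1" then show ?thesis using xe by simp
  next
    assume "v l \<bullet> x = -1"
    then have "x = (-1) \<cdot>\<^sub>v v l" using xe by simp
    then show ?thesis using c[OF l] by (auto intro!: eq_vecI)
  qed
qed

lemma spectral_mat_cong:
  assumes "\<And>k. k \<in> {1..r} \<Longrightarrow> lam k = mu k" "\<And>k. k \<in> {1..r} \<Longrightarrow> u k = v k"
  shows "spectral_mat n r lam u = spectral_mat n r mu v"
  unfolding spectral_mat_def using assms by (intro arg_cong[where f="mat n n"] ext) (auto intro!: sum.cong)

lemma spectral_mat_pad_zero: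
  assumes "r \<le> n"
  shows "spectral_mat n r lam e = spectral_mat n n (\<lambda>k. if k \<le> r then lam k else 0) e"
proof -
  have "(\<Sum>k = 1..r. lam k * e k $ i * e k $ j)
    = (\<Sum>k = 1..n. (if k \<le> r then lam k else 0) * e k $ i * e k $ j)" for i j
    using assms by (intro sum.mono_neutral_cong_left) auto
  then show ?thesis unfolding spectral_mat_def by simp
qed

lemma spectral_mat_split:
  assumes "r \<le> m"
  shows "spectral_mat n m lam e
     = spectral_mat n r lam e + spectral_mat n (m - r) (\<lambda>k. lam (k + r)) (\<lambda>k. e (k + r))"
proof -
  have "(\<Sum>k = 1..m. f k) = (\<Sum>k = 1..r. f k) + (\<Sum>k = 1..m - r. f (k + r))" for f :: "nat \<Rightarrow> real"
    using sum.ub_add_nat[of 1 r f "m - r"] sum.shift_bounds_cl_nat_ivl[of f 1 r "m - r"] assms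
    by (simp add: add.commute)
  then show ?thesis unfolding spectral_mat_def by (intro eq_matI) auto
qed

text \<open>
  The matrix is a sum of \<open>r\<close> outer products, and rank is subadditive.
\<close>

lemma rank_spectral_mat_le: "vec_space.rank n (spectral_mat n r lam v) \<le> r"
proof (induction r)
  case 0
  have "spectral_mat n 0 lam v = 0\<^sub>m n n" unfolding spectral_mat_def by auto
  then show ?case using vec_space.rank_0I[of n n] by simp
next
  case (Suc r)
  let ?O = "mat n n (\<lambda>(i, j). lam (Suc r) * v (Suc r) $ i * v (Suc r) $ j)"
  have "spectral_mat n (Suc r) lam v = spectral_mat n r lam v + ?O"
    unfolding spectral_mat_def by (intro eq_matI) auto
  moreover have "vec_space.rank n ?O \<le> 1"
    by (rule vec_space.rank_le_1_product_entries[where nc=n and f="\<lambda>i. lam (Suc r) * v (Suc r) $ i" and g="\<lambda>j. v (Suc r) $ j"]) auto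
  ultimately show ?case
    using vec_space.rank_subadditive[of "spectral_mat n r lam v" n n ?O] Suc by simp
qed

definition basis_mat :: "nat \<Rightarrow> (nat \<Rightarrow> real vec) \<Rightarrow> real mat" where
  "basis_mat n e = mat n n (\<lambda>(i, j). e (j + 1) $ i)"

lemma basis_mat_carrier [simp]: "basis_mat n e \<in> carrier_mat n n"
  unfolding basis_mat_def by simp

lemma col_basis_mat:
  assumes "orthonormal n n e" "i < n"
  shows "col (basis_mat n e) i = e (i + 1)"
proof -
  have "e (i + 1) \<in> carrier_vec n" using assms by (auto simp: orthonormal_def)
  then show ?thesis using assms(2) by (intro eq_vecI) (auto simp: basis_mat_def)
qed

lemma basis_mat_orthogonal:
  assumes "orthonormal n n e"
  shows "transpose_mat (basis_mat n e) * basis_mat n e = 1\<^sub>m n"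
    "basis_mat n e * transpose_mat (basis_mat n e) = 1\<^sub>m n"
proof -
  show 1: "transpose_mat (basis_mat n e) * basis_mat n e = 1\<^sub>m n"
  proof (intro eq_matI)
    fix i j assume "i < dim_row (1\<^sub>m n)" "j < dim_col (1\<^sub>m n)"
    then have ij: "i < n" "j < n" by auto
    have "col (basis_mat n e) k = e (k + 1)" if "k < n" for k
      using assms that by (rule col_basis_mat)
    then show "(transpose_mat (basis_mat n e) * basis_mat n e) $$ (i, j) = 1\<^sub>m n $$ (i, j)"
      using ij assms by (simp add: orthonormal_def basis_mat_def)
  qed (auto simp: basis_mat_def)
  show "basis_mat n e * transpose_mat (basis_mat n e) = 1\<^sub>m n"
    by (rule mat_mult_left_right_inverse[OF _ _ 1]) auto
qed

text \<open>
  A kernel vector is orthogonal to every basis vector.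
\<close>

lemma det_spectral_mat_nonzero:
  assumes e: "orthonormal n n e" and nz: "\<forall>k\<in>{1..n}. mu k \<noteq> 0"
  shows "det (spectral_mat n n mu e) \<noteq> 0"
proof
  assume "det (spectral_mat n n mu e) = 0"
  then obtain x where x: "x \<in> carrier_vec n" "x \<noteq> 0\<^sub>v n" "spectral_mat n n mu e *\<^sub>v x = 0\<^sub>v n"
    using det_0_iff_vec_prod_zero_field[OF spectral_mat_carrier] by blast
  have z: "e k \<bullet> x = 0" if "k \<in> {1..n}" for k
    using scalar_prod_spectral_mat[OF e x(1) that, of mu] x(3) that nz e by (auto simp: orthonormal_def)
  have "transpose_mat (basis_mat n e) *\<^sub>v x = 0\<^sub>v n"
  proof (intro eq_vecI)
    fix i assume "i < dim_vec (0\<^sub>v n)"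
    then have i: "i < n" by simp
    have "col (basis_mat n e) i = e (i + 1)"
      using e i by (rule col_basis_mat)
    then show "(transpose_mat (basis_mat n e) *\<^sub>v x) $ i = 0\<^sub>v n $ i"
      using i z[of "i + 1"] by (simp add: basis_mat_def)
  qed (simp add: basis_mat_def)
  then have "basis_mat n e *\<^sub>v (transpose_mat (basis_mat n e) *\<^sub>v x) = 0\<^sub>v n"
    by (auto simp: basis_mat_def intro!: eq_vecI)
  moreover have "basis_mat n e *\<^sub>v (transpose_mat (basis_mat n e) *\<^sub>v x) = (basis_mat n e * transpose_mat (basis_mat n e)) *\<^sub>v x"
    by (rule assoc_mult_mat_vec[symmetric, of _ n n _ n]) (use x in auto)
  ultimately show False using x basis_mat_orthogonal[OF e] by simp
qed

text \<open>
  Subadditivity of the rank is used a second time for the lower bound: an invertible matrix is the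
  sum of the given one and of \<open>n - r\<close> outer products.
\<close>

lemma rank_spectral_mat:
  assumes v: "orthonormal n r v" and r: "r \<le> n" and nz: "\<forall>k\<in>{1..r}. lam k \<noteq> 0"
  shows "vec_space.rank n (spectral_mat n r lam v) = r"
proof -
  obtain e where e: "orthonormal n n e" "\<forall>k\<in>{1..r}. e k = v k"
    using orthonormal_extension[OF v r] by auto
  \<comment> \<open>Completing the spectrum by ones gives an invertible matrix, and the completion has rank at most \<open>n - r\<close>.\<close>
  define mu where "mu k = (if k \<le> r then lam k else 1)" for k
  let ?C = "spectral_mat n (n - r) (\<lambda>k. mu (k + r)) (\<lambda>k. e (k + r))"
  have "det (spectral_mat n n mu e) \<noteq> 0"
    using nz by (intro det_spectral_mat_nonzero e) (auto simp: mu_def)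
  then have "n = vec_space.rank n (spectral_mat n n mu e)"
    using vec_space.det_rank_iff[OF spectral_mat_carrier] by metis
  also have "spectral_mat n n mu e = spectral_mat n r lam v + ?C"
    unfolding spectral_mat_split[OF r, of n mu e]
    using e(2) by (intro arg_cong2[where f="(+)"] spectral_mat_cong) (auto simp: mu_def)
  also have "vec_space.rank n \<dots> \<le> vec_space.rank n (spectral_mat n r lam v) + vec_space.rank n ?C"
    by (rule vec_space.rank_subadditive[OF spectral_mat_carrier spectral_mat_carrier])
  also have "\<dots> \<le> vec_space.rank n (spectral_mat n r lam v) + (n - r)"
    by (intro add_left_mono rank_spectral_mat_le)
  finally have "r \<le> vec_space.rank n (spectral_mat n r lam v)" using r by simp
  then show ?thesis using rank_spectral_mat_le[of n r lam v] by simp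
qed

text \<open>
  The matrix whose columns are the basis vectors diagonalises the spectral matrix.
\<close>

lemma char_poly_spectral_mat:
  assumes e: "orthonormal n n e"
  shows "char_poly (spectral_mat n n mu e) = (\<Prod>k\<leftarrow>[1..<n + 1]. [:- mu k, 1:])"
proof -
  let ?U = "basis_mat n e" and ?S = "spectral_mat n n mu e"
  define D where "D = mat n n (\<lambda>(i, j). if i = j then mu (i + 1) else 0)"
  have D: "D \<in> carrier_mat n n" unfolding D_def by simp
  have "?S * ?U = ?U * D"
  proof (intro eq_matI)
    fix i j assume "i < dim_row (?U * D)" "j < dim_col (?U * D)"
    then have ij: "i < n" "j < n" by (auto simp: basis_mat_def D_def)
    have c: "col ?U j = e (j + 1)" "e (j + 1) \<in> carrier_vec n"
      using e ij col_basis_mat[OF e, of j] by (auto simp: orthonormal_def)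
    have "(?S * ?U) $$ (i, j) = (?S *\<^sub>v e (j + 1)) $ i"
      using ij c by (simp add: basis_mat_def spectral_mat_def)
    also have "\<dots> = mu (j + 1) * e (j + 1) $ i"
      using spectral_mat_eigenvector[OF e, of "j + 1" mu] ij c by simp
    also have "\<dots> = (\<Sum>k<n. ?U $$ (i, k) * D $$ (k, j))"
    proof -
      have "(\<Sum>k<n. ?U $$ (i, k) * D $$ (k, j)) = (\<Sum>k<n. if k = j then mu (j + 1) * e (j + 1) $ i else 0)"
        using ij by (intro sum.cong refl) (auto simp: basis_mat_def D_def)
      then show ?thesis using ij by simp
    qed
    also have "\<dots> = (?U * D) $$ (i, j)"
      using ij by (simp add: basis_mat_def D_def scalar_prod_def lessThan_atLeast0)
    finally show "(?S * ?U) $$ (i, j) = (?U * D) $$ (i, j)" .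
  qed (auto simp: basis_mat_def D_def spectral_mat_def)
  then have "?U * D * transpose_mat ?U = ?S * (?U * transpose_mat ?U)"
    by (metis assoc_mult_mat basis_mat_carrier spectral_mat_carrier transpose_carrier_mat)
  then have S: "?S = ?U * D * transpose_mat ?U"
    using basis_mat_orthogonal[OF e] right_mult_one_mat[OF spectral_mat_carrier, of n n mu e] by simp
  have "similar_mat_wit ?S D ?U (transpose_mat ?U)"
    by (rule similar_mat_witI[OF basis_mat_orthogonal(2,1)[OF e] S]) (auto simp: D)
  then have "char_poly ?S = char_poly D"
    by (intro char_poly_similar) (auto simp: similar_mat_def)
  also have "\<dots> = (\<Prod>a\<leftarrow>diag_mat D. [:- a, 1:])"
    by (rule char_poly_upper_triangular[OF D]) (auto simp: D_def)
  also have "diag_mat D = map mu [1..<n + 1]"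
    by (rule nth_equalityI) (auto simp: diag_mat_def D_def simp del: upt_Suc)
  finally show ?thesis by (simp add: o_def)
qed

lemma proots_linear_factors: "proots (\<Prod>a\<leftarrow>as. [:- a, 1:]) = mset (as :: real list)"
proof (induction as)
  case (Cons a as)
  have "(\<Prod>a\<leftarrow>as. [:- a, 1:]) \<noteq> 0" by (auto simp: prod_list_zero_iff)
  then show ?case using Cons by (simp add: proots_mult del: mult_pCons_left)
qed simp

lemma nz_eigenvalues_spectral_mat:
  assumes v: "orthonormal n r v" and r: "r \<le> n" and nz: "\<forall>k\<in>{1..r}. lam k \<noteq> 0"
    and dec: "\<forall>j\<in>{1..r}. \<forall>k\<in>{1..r}. j \<le> k \<longrightarrow> lam k \<le> lam j"
  shows "nz_eigenvalues (spectral_mat n r lam v) = map lam [1..<r + 1]"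
proof -
  obtain e where e: "orthonormal n n e" "\<forall>k\<in>{1..r}. e k = v k"
    using orthonormal_extension[OF v r] by auto
  define mu where "mu k = (if k \<le> r then lam k else 0)" for k
  have "spectral_mat n r lam v = spectral_mat n n mu e"
    using e(2) spectral_mat_pad_zero[OF r, of lam e] spectral_mat_cong[of r lam lam v e n]
    by (simp add: mu_def[abs_def])
  then have "proots (char_poly (spectral_mat n r lam v)) = mset (map mu [1..<n + 1])"
    using proots_linear_factors[of "map mu [1..<n + 1]"] char_poly_spectral_mat[OF e(1), of mu]
    by (simp add: o_def)
  also have "[1..<n + 1] = [1..<r + 1] @ [r + 1..<n + 1]"
    using r upt_add_eq_append[of 1 "r + 1" "n - r"] by simp
  also have "filter_mset (\<lambda>x. x \<noteq> 0) (mset (map mu \<dots>)) = mset (map lam [1..<r + 1])"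
  proof -
    have "filter (\<lambda>x. x \<noteq> 0) (map mu [1..<r + 1]) = map lam [1..<r + 1]"
      using nz by (subst filter_True) (auto simp: mu_def)
    moreover have "filter (\<lambda>x. x \<noteq> 0) (map mu [r + 1..<n + 1]) = []"
      by (auto simp: mu_def filter_empty_conv)
    ultimately show ?thesis by (simp only: mset_filter[symmetric] map_append filter_append append_Nil2)
  qed
  finally have "nz_eigenvalues (spectral_mat n r lam v) = rev (sort (map lam [1..<r + 1]))"
    unfolding nz_eigenvalues_def by (simp only: sorted_list_of_multiset_mset)
  also have "sort (map lam [1..<r + 1]) = rev (map lam [1..<r + 1])"
  proof (rule properties_for_sort)
    show "sorted (rev (map lam [1..<r + 1]))"
      unfolding sorted_wrt_rev using dec
      by (auto simp: sorted_wrt_iff_nth_less nth_append simp del: upt_Suc)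
  qed simp
  finally show ?thesis by simp
qed

text \<open>
  Every choice of orthonormal eigenvectors with the given eigenvalues lies in the isospectral class.
  This supplies all hypotheses of the lower bounds.
\<close>

lemma spectral_mat_isospectral:
  assumes v: "orthonormal n r v" and r: "r \<le> n" and nz: "\<forall>k\<in>{1..r}. lam k \<noteq> 0"
    and dec: "\<forall>j\<in>{1..r}. \<forall>k\<in>{1..r}. j \<le> k \<longrightarrow> lam k \<le> lam j"
  shows "spectral_mat n r lam v \<in> isospectral n r lam"
proof -
  have "transpose_mat (spectral_mat n r lam v) = spectral_mat n r lam v"
    unfolding spectral_mat_def by (intro eq_matI) (auto simp: ac_simps)
  moreover have "nth_eigenvalue i (spectral_mat n r lam v) = lam i" if "i \<in> {1..r}" for i
    using that nz_eigenvalues_spectral_mat[OF assms]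
    by (auto simp: nth_eigenvalue_def simp del: upt_Suc)
  ultimately show ?thesis
    unfolding isospectral_def using rank_spectral_mat[OF v r nz] by simp
qed

text \<open>
  The chosen eigenvector of a hypothesis is the planted one up to sign, which the losses ignore.
\<close>

lemma nth_eigenvector_spectral_mat:
  assumes v: "orthonormal n r v" and r: "r \<le> n" and nz: "\<forall>k\<in>{1..r}. lam k \<noteq> 0"
    and dec: "\<forall>j\<in>{1..r}. \<forall>k\<in>{1..r}. j \<le> k \<longrightarrow> lam k \<le> lam j"
    and l: "l \<in> {1..r}" and simple: "\<forall>k\<in>{1..r} - {l}. lam k \<noteq> lam l"
  shows "nth_eigenvector l (spectral_mat n r lam v) = v l
       \<or> nth_eigenvector l (spectral_mat n r lam v) = - v l"
proof -
  let ?S = "spectral_mat n r lam v"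
  have val: "nth_eigenvalue l ?S = lam l"
    using spectral_mat_isospectral[OF v r nz dec] l by (auto simp: isospectral_def)
  have vl: "v l \<in> carrier_vec n" "v l \<bullet> v l = 1" using v l by (auto simp: orthonormal_def)
  then have "v l \<noteq> 0\<^sub>v n" by auto
  then have "eigenvector ?S (v l) (lam l) \<and> norm2 (v l) = 1"
    using spectral_mat_eigenvector[OF v l, of lam] vl by (simp add: eigenvector_def norm2_def)
      (simp add: spectral_mat_def)
  then have "eigenvector ?S (nth_eigenvector l ?S) (lam l) \<and> norm2 (nth_eigenvector l ?S) = 1"
    unfolding nth_eigenvector_def val by (rule someI)
  then show ?thesis
    using l nz norm2_power2[of "nth_eigenvector l ?S"]
    by (intro simple_eigenvector_unique[OF v l _ simple]) (auto simp: eigenvector_def spectral_mat_def)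
qed

section \<open>Perturbed eigenvectors\<close>

text \<open>
  Expanding the square leaves \<open>(x \<bullet> x)\<^sup>2 - 2 * (x \<bullet> y)\<^sup>2 + (y \<bullet> y)\<^sup>2\<close>, the squared
  Frobenius distance of the two rank-one projections.
\<close>

lemma frob_norm_outer_diff:
  assumes "x \<in> carrier_vec n" "y \<in> carrier_vec n" "x \<bullet> x = 1" "y \<bullet> y = 1"
  shows "frob_norm (mat n n (\<lambda>(i, j). c * (x $ i * x $ j - y $ i * y $ j)))
     = \<bar>c\<bar> * sqrt (2 - 2 * (x \<bullet> y)\<^sup>2)"
proof -
  have p: "(\<Sum>i<n. \<Sum>j<n. f i * f j) = (\<Sum>i<n. f i)\<^sup>2" for f :: "nat \<Rightarrow> real"
    by (simp add: power2_eq_square sum_product)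
  have "(\<Sum>i<n. \<Sum>j<n. (c * (x $ i * x $ j - y $ i * y $ j))\<^sup>2)
     = (\<Sum>i<n. \<Sum>j<n. c\<^sup>2 * ((x $ i * x $ i) * (x $ j * x $ j)
          - 2 * ((x $ i * y $ i) * (x $ j * y $ j)) + (y $ i * y $ i) * (y $ j * y $ j)))"
    by (intro sum.cong refl) (simp add: power2_eq_square algebra_simps)
  also have "\<dots> = c\<^sup>2 * ((\<Sum>i<n. x $ i * x $ i)\<^sup>2 - 2 * (\<Sum>i<n. x $ i * y $ i)\<^sup>2 + (\<Sum>i<n. y $ i * y $ i)\<^sup>2)"
    by (simp only: p[symmetric] sum_distrib_left[symmetric] sum.distrib sum_subtractf)
  also have "\<dots> = c\<^sup>2 * (2 - 2 * (x \<bullet> y)\<^sup>2)"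
    using assms by (simp add: scalar_prod_def lessThan_atLeast0)
  finally show ?thesis unfolding frob_norm_def by (simp add: real_sqrt_mult)
qed

lemma spectral_mat_replace_diff:
  assumes l: "l \<in> {1..r}"
  shows "spectral_mat n r lam (v(l := x)) - spectral_mat n r lam (v(l := y))
     = mat n n (\<lambda>(i, j). lam l * (x $ i * x $ j - y $ i * y $ j))"
proof -
  have "(\<Sum>k = 1..r. lam k * (v(l := z)) k $ i * (v(l := z)) k $ j)
      = lam l * z $ i * z $ j + (\<Sum>k\<in>{1..r} - {l}. lam k * v k $ i * v k $ j)" for z i j
    using l by (subst sum.remove[of _ l]) auto
  then show ?thesis unfolding spectral_mat_def by (intro eq_matI) (auto simp: algebra_simps)
qed

definition rotate_pair :: "(nat \<Rightarrow> real vec) \<Rightarrow> nat \<Rightarrow> nat \<Rightarrow> real \<Rightarrow> real \<Rightarrow> nat \<Rightarrow> real vec" where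
  "rotate_pair e l k c s = e(l := c \<cdot>\<^sub>v e l + s \<cdot>\<^sub>v e k, k := (- s) \<cdot>\<^sub>v e l + c \<cdot>\<^sub>v e k)"

lemma orthonormal_rotate_pair:
  assumes e: "orthonormal n m e" and lk: "l \<in> {1..m}" "k \<in> {1..m}" "l \<noteq> k" and cs: "c\<^sup>2 + s\<^sup>2 = 1"
  shows "orthonormal n m (rotate_pair e l k c s)"
proof -
  have c: "e j \<in> carrier_vec n" if "j \<in> {1..m}" for j using e that by (auto simp: orthonormal_def)
  have o: "e i \<bullet> e j = (if i = j then 1 else 0)" if "i \<in> {1..m}" "j \<in> {1..m}" for i j
    using e that unfolding orthonormal_def by blast
  have ip: "(a \<cdot>\<^sub>v e l + b \<cdot>\<^sub>v e k) \<bullet> x = a * (e l \<bullet> x) + b * (e k \<bullet> x)"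
      "x \<bullet> (a \<cdot>\<^sub>v e l + b \<cdot>\<^sub>v e k) = a * (x \<bullet> e l) + b * (x \<bullet> e k)"
    if "x \<in> carrier_vec n" for a b x
    using that c[OF lk(1)] c[OF lk(2)]
    by (simp_all add: add_scalar_prod_distrib[of _ n] scalar_prod_add_distrib[of _ n])
  show ?thesis
    unfolding orthonormal_def rotate_pair_def
    using c lk o cs by (auto simp: ip power2_eq_square algebra_simps)
qed

lemma rotate_pair_id:
  assumes "e l \<in> carrier_vec n" "e k \<in> carrier_vec n"
  shows "rotate_pair e l k 1 0 = e"
proof -
  have "1 \<cdot>\<^sub>v e l + 0 \<cdot>\<^sub>v e k = e l" "(- 0) \<cdot>\<^sub>v e l + 1 \<cdot>\<^sub>v e k = e k"
    using assms by (auto intro!: eq_vecI)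
  then show ?thesis unfolding rotate_pair_def by simp
qed

lemma rotate_pair_inner:
  assumes e: "orthonormal n n e" and lk: "l \<in> {1..n}" "k \<in> {1..n}" "l \<noteq> k" and cs: "c\<^sup>2 + s\<^sup>2 = 1"
  shows "rotate_pair e l k c s l \<in> carrier_vec n" "rotate_pair e l k c s l \<bullet> rotate_pair e l k c s l = 1"
    "rotate_pair e l k c s l \<bullet> e l = c"
    "a \<in> carrier_vec n \<Longrightarrow> a \<bullet> rotate_pair e l k c s l = c * (a \<bullet> e l) + s * (a \<bullet> e k)"
proof -
  have o: "orthonormal n n (rotate_pair e l k c s)" by (rule orthonormal_rotate_pair[OF assms])
  have c: "e l \<in> carrier_vec n" "e k \<in> carrier_vec n" "e l \<bullet> e l = 1" "e k \<bullet> e l = 0"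
    using e lk by (auto simp: orthonormal_def)
  show "rotate_pair e l k c s l \<in> carrier_vec n" "rotate_pair e l k c s l \<bullet> rotate_pair e l k c s l = 1"
    using o lk by (auto simp: orthonormal_def)
  have x: "rotate_pair e l k c s l = c \<cdot>\<^sub>v e l + s \<cdot>\<^sub>v e k" using lk by (simp add: rotate_pair_def)
  show "rotate_pair e l k c s l \<bullet> e l = c" unfolding x using c by (simp add: add_scalar_prod_distrib[of _ n])
  show "a \<bullet> rotate_pair e l k c s l = c * (a \<bullet> e l) + s * (a \<bullet> e k)" if "a \<in> carrier_vec n"
    unfolding x using c that by (simp add: scalar_prod_add_distrib[of _ n])
qed

text \<open>
  A rotation in the plane of \<open>e l\<close> and \<open>e k\<close> preserves the projection onto that plane. Hence the
  common part \<open>mu k\<close> of the two eigenvalues drops out and only their difference \<open>mu l - mu k\<close> is felt. This is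
  why a small gap makes the eigenvector hard to estimate.
\<close>

lemma spectral_mat_rotate_diff:
  assumes e: "orthonormal n n e" and lk: "l \<in> {1..n}" "k \<in> {1..n}" "l \<noteq> k" and cs: "c\<^sup>2 + s\<^sup>2 = 1"
  shows "spectral_mat n n mu (rotate_pair e l k c s) - spectral_mat n n mu e
     = mat n n (\<lambda>(i, j). (mu l - mu k) *
         ((c \<cdot>\<^sub>v e l + s \<cdot>\<^sub>v e k) $ i * (c \<cdot>\<^sub>v e l + s \<cdot>\<^sub>v e k) $ j - e l $ i * e l $ j))"
proof -
  have d: "dim_vec (e l) = n" "dim_vec (e k) = n" using e lk by (auto simp: orthonormal_def)
  have split: "(\<Sum>j = 1..n. f j) = f l + f k + (\<Sum>j\<in>{1..n} - {l} - {k}. f j)" for f :: "nat \<Rightarrow> real"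
    using lk sum.remove[of "{1..n}" l f] sum.remove[of "{1..n} - {l}" k f] by auto
  have "(\<Sum>p = 1..n. mu p * rotate_pair e l k c s p $ i * rotate_pair e l k c s p $ j)
       - (\<Sum>p = 1..n. mu p * e p $ i * e p $ j)
     = (mu l - mu k) * ((c \<cdot>\<^sub>v e l + s \<cdot>\<^sub>v e k) $ i * (c \<cdot>\<^sub>v e l + s \<cdot>\<^sub>v e k) $ j - e l $ i * e l $ j)"
    if ij: "i < n" "j < n" for i j
  proof -
    let ?f = "\<lambda>u p. mu p * u p $ i * u p $ j :: real"
    have rest: "(\<Sum>p\<in>{1..n} - {l} - {k}. ?f (rotate_pair e l k c s) p) = (\<Sum>p\<in>{1..n} - {l} - {k}. ?f e p)"
      by (intro sum.cong) (auto simp: rotate_pair_def)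
    have key: "(c * b - s * a) * (c * b' - s * a') = a * a' + b * b' - (c * a + s * b) * (c * a' + s * b')"
      for a a' b b'
    proof -
      have "(c * b - s * a) * (c * b' - s * a') + (c * a + s * b) * (c * a' + s * b') = (c\<^sup>2 + s\<^sup>2) * (a * a' + b * b')"
        by (simp add: power2_eq_square algebra_simps)
      with cs show ?thesis by simp
    qed
    have "rotate_pair e l k c s k $ i * rotate_pair e l k c s k $ j
       = e l $ i * e l $ j + e k $ i * e k $ j - (c * e l $ i + s * e k $ i) * (c * e l $ j + s * e k $ j)"
      using ij d by (simp add: rotate_pair_def key[symmetric])
    then have k: "mu k * rotate_pair e l k c s k $ i * rotate_pair e l k c s k $ j
       = mu k * (e l $ i * e l $ j + e k $ i * e k $ j - (c * e l $ i + s * e k $ i) * (c * e l $ j + s * e k $ j))"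
      by (simp add: mult.assoc)
    have l: "rotate_pair e l k c s l = c \<cdot>\<^sub>v e l + s \<cdot>\<^sub>v e k" using lk by (simp add: rotate_pair_def)
    show ?thesis
      unfolding split[of "?f (rotate_pair e l k c s)"] split[of "?f e"] rest
      unfolding k l using ij d by (simp add: algebra_simps)
  qed
  then show ?thesis unfolding spectral_mat_def by (intro eq_matI) auto
qed

lemma frob_norm_rotate:
  assumes e: "orthonormal n n e" and lk: "l \<in> {1..n}" "k \<in> {1..n}" "l \<noteq> k" and cs: "c\<^sup>2 + s\<^sup>2 = 1"
  shows "frob_norm (spectral_mat n n mu (rotate_pair e l k c s) - spectral_mat n n mu e)
     = \<bar>mu l - mu k\<bar> * (sqrt 2 * \<bar>s\<bar>)"
proof -
  let ?x = "c \<cdot>\<^sub>v e l + s \<cdot>\<^sub>v e k"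
  have x: "?x = rotate_pair e l k c s l" using lk by (simp add: rotate_pair_def)
  have o: "orthonormal n n (rotate_pair e l k c s)" by (rule orthonormal_rotate_pair[OF assms])
  have c: "e l \<in> carrier_vec n" "e k \<in> carrier_vec n" "e l \<bullet> e l = 1" "e k \<bullet> e l = 0"
    using e lk by (auto simp: orthonormal_def)
  have "?x \<bullet> e l = c" using c by (simp add: add_scalar_prod_distrib[of _ n])
  moreover have "?x \<bullet> ?x = 1" "?x \<in> carrier_vec n" using o lk unfolding x orthonormal_def by auto
  ultimately have "frob_norm (spectral_mat n n mu (rotate_pair e l k c s) - spectral_mat n n mu e)
     = \<bar>mu l - mu k\<bar> * sqrt (2 - 2 * c\<^sup>2)"
    unfolding spectral_mat_rotate_diff[OF assms] using c by (subst frob_norm_outer_diff) auto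
  also have "2 - 2 * c\<^sup>2 = 2 * s\<^sup>2" using cs by (simp add: algebra_simps)
  finally show ?thesis by (simp add: real_sqrt_mult)
qed

text \<open>
  The sine \<open>smin / (8 * g)\<close> is, up to a constant, the largest tilt that the noise hides.
\<close>

lemma frob_norm_rotate_le:
  assumes e: "orthonormal n n e" and r: "r \<le> n" and l: "l \<in> {1..r}" and k: "k \<in> {1..n}" "k \<noteq> l"
    and cs: "c\<^sup>2 + s\<^sup>2 = 1" and g: "g = \<bar>lam l - (if k \<le> r then lam k else 0)\<bar>"
    and smin: "0 < smin" and g0: "0 < g" and s: "\<bar>s\<bar> \<le> smin / (8 * g)"
  shows "frob_norm (spectral_mat n r lam (rotate_pair e l k c s) - spectral_mat n r lam e) \<le> smin / 2"
proof -
  have "l \<in> {1..n}" using l r by auto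
  then have "frob_norm (spectral_mat n r lam (rotate_pair e l k c s) - spectral_mat n r lam e) = g * (sqrt 2 * \<bar>s\<bar>)"
    unfolding spectral_mat_pad_zero[OF r] using g l k by (subst frob_norm_rotate[OF e _ k(1) _ cs]) auto
  also have "\<dots> \<le> g * (2 * (smin / (8 * g)))"
    using s g0 by (intro mult_left_mono mult_mono) (auto intro: real_le_lsqrt)
  also have "\<dots> \<le> smin / 2" using g0 smin by (simp add: field_simps)
  finally show ?thesis .
qed

section \<open>Overlap of Gaussian likelihoods\<close>

lemma prob_space_gauss: "s \<noteq> 0 \<Longrightarrow> prob_space (density lborel (\<lambda>x. ennreal (normal_density m s x)))"
proof -
  assume "s \<noteq> 0"
  moreover have "normal_density m s = normal_density m \<bar>s\<bar>" by (simp add: normal_density_def fun_eq_iff)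
  ultimately show ?thesis using prob_space_normal_density[of "\<bar>s\<bar>" m] by simp
qed

lemma normal_density_translate:
  "distr (density lborel (\<lambda>x. ennreal (normal_density 0 s x))) borel (\<lambda>x. m + x)
     = density lborel (\<lambda>x. ennreal (normal_density m s x))"
proof -
  have "distr (density lborel (\<lambda>x. ennreal (normal_density 0 s x))) borel (\<lambda>x. m + x)
     = distr (density lborel (\<lambda>x. ennreal (normal_density m s (m + x)))) borel (\<lambda>x. m + x)"
    by (simp add: normal_density_def)
  also have "\<dots> = density (distr lborel borel (\<lambda>x. m + x)) (\<lambda>x. ennreal (normal_density m s x))"
    by (subst density_distr) auto
  finally show ?thesis using lborel_distr_plus[of m] by simp
qed

text \<open>
  Completing the square: the geometric mean of two normal densities is again a normal density,
  centred at the midpoint, times the Hellinger affinity.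
\<close>

lemma sqrt_normal_density_mult:
  "sqrt (normal_density a s x * normal_density b s x)
    = exp (- (a - b)\<^sup>2 / (8 * s\<^sup>2)) * normal_density ((a + b) / 2) s x"
proof (cases "s = 0")
  case True then show ?thesis by (simp add: normal_density_def)
next
  case False
  have "normal_density a s x * normal_density b s x
     = (exp (- (a - b)\<^sup>2 / (8 * s\<^sup>2)) * normal_density ((a + b) / 2) s x)\<^sup>2"
    using False unfolding normal_density_def power2_eq_square
    by (simp add: mult_exp_exp field_simps)
  then show ?thesis
    by (simp only: real_sqrt_abs) simp
qed

text \<open>
  The density of the observed matrix with respect to Lebesgue measure on the entries, when the
  signal is \<open>A\<close>.
\<close>

definition likelihood :: "nat \<Rightarrow> (nat \<Rightarrow> nat \<Rightarrow> real) \<Rightarrow> real mat \<Rightarrow> (nat \<times> nat \<Rightarrow> real) \<Rightarrow> real" where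
  "likelihood n sd A x = (\<Prod>p\<in>{..<n} \<times> {..<n}. normal_density (A $$ p) (case_prod sd p) (x p))"

abbreviation lebesgue_entries :: "nat \<Rightarrow> (nat \<times> nat \<Rightarrow> real) measure" where
  "lebesgue_entries n \<equiv> PiM ({..<n} \<times> {..<n}) (\<lambda>_. lborel)"

lemma likelihood_nonneg: "0 \<le> likelihood n sd A x"
  unfolding likelihood_def by (intro prod_nonneg) auto

lemma sets_lebesgue_entries: "sets (lebesgue_entries n) = sets (entry_space n)"
  unfolding entry_space_def by (intro sets_PiM_cong) auto

lemma likelihood_measurable: "(\<lambda>x. likelihood n sd A x) \<in> borel_measurable (lebesgue_entries n)"
  unfolding likelihood_def by measurable

text \<open>
  Both sides agree with the product of the entrywise normal laws on measurable boxes.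
\<close>

lemma noise_law_translate:
  assumes sd: "\<And>i j. i < n \<Longrightarrow> j < n \<Longrightarrow> sd i j \<noteq> 0"
  shows "distr (noise_law n sd) (entry_space n)
      (\<lambda>h. \<lambda>p\<in>{..<n} \<times> {..<n}. A $$ p + h p)
    = density (lebesgue_entries n) (\<lambda>x. ennreal (likelihood n sd A x))" (is "?L = ?R")
proof -
  let ?I = "{..<n} \<times> {..<n}"
  define s where "s p = (if p \<in> ?I then case_prod sd p else 1)" for p
  have s0: "s p \<noteq> 0" for p using sd by (auto simp: s_def)
  let ?M = "\<lambda>m p. density lborel (\<lambda>x. ennreal (normal_density (m p) (s p) x))"
  interpret N: product_prob_space "?M (\<lambda>_. 0)" ?I
    by (intro product_prob_spaceI prob_space_gauss s0)
  interpret T: product_prob_space "?M (\<lambda>p. A $$ p)" ?I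
    by (intro product_prob_spaceI prob_space_gauss s0)
  interpret B: product_sigma_finite "\<lambda>_. lborel :: real measure"
    by standard
  have noise: "noise_law n sd = PiM ?I (?M (\<lambda>_. 0))"
    unfolding noise_law_def
    by (intro PiM_cong) (use sd in \<open>auto simp: centered_normal_def s_def\<close>)
  have shift: "emeasure (?M (\<lambda>_. 0) p) ((\<lambda>x. A $$ p + x) -` E) = emeasure (?M (\<lambda>p. A $$ p) p) E"
    if "E \<in> sets borel" for p E
    using that by (subst normal_density_translate[symmetric]) (simp add: emeasure_distr)
  have L: "?L = PiM ?I (?M (\<lambda>p. A $$ p))"
  proof (rule T.PiM_eqI)
    show "sets ?L = sets (PiM ?I (?M (\<lambda>p. A $$ p)))"
      unfolding entry_space_def by (simp, intro sets_PiM_cong) auto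
  next
    fix E assume "\<And>p. p \<in> ?I \<Longrightarrow> E p \<in> sets (?M (\<lambda>p. A $$ p) p)"
    then have E: "\<And>p. p \<in> ?I \<Longrightarrow> E p \<in> sets borel" by simp
    have [measurable]: "(\<lambda>h. \<lambda>p\<in>?I. A $$ p + h p) \<in> measurable (PiM ?I (?M (\<lambda>_. 0))) (entry_space n)"
      unfolding entry_space_def by measurable
    have pre: "(\<lambda>x. A $$ p + x) -` E p \<in> sets borel" if "p \<in> ?I" for p
      using measurable_sets_borel[of "\<lambda>x. A $$ p + x" borel "E p"] E[OF that] by simp
    have "emeasure ?L (Pi\<^sub>E ?I E) = emeasure (PiM ?I (?M (\<lambda>_. 0))) (\<Pi>\<^sub>E p\<in>?I. (\<lambda>x. A $$ p + x) -` E p)"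
      unfolding noise
      by (subst emeasure_distr)
         (auto simp: space_PiM entry_space_def E intro!: sets_PiM_I_finite arg_cong[where f="emeasure _"]
               simp: PiE_iff)
    also have "\<dots> = (\<Prod>p\<in>?I. emeasure (?M (\<lambda>_. 0) p) ((\<lambda>x. A $$ p + x) -` E p))"
      by (subst N.emeasure_PiM) (use pre in auto)
    also have "\<dots> = (\<Prod>p\<in>?I. emeasure (?M (\<lambda>p. A $$ p) p) (E p))"
      by (intro prod.cong refl shift E)
    finally show "emeasure ?L (Pi\<^sub>E ?I E) = (\<Prod>p\<in>?I. emeasure (?M (\<lambda>p. A $$ p) p) (E p))" .
  qed auto
  have R: "?R = PiM ?I (?M (\<lambda>p. A $$ p))"
  proof (rule T.PiM_eqI)
    show "sets ?R = sets (PiM ?I (?M (\<lambda>p. A $$ p)))"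
      by (simp, intro sets_PiM_cong) auto
  next
    fix E assume "\<And>p. p \<in> ?I \<Longrightarrow> E p \<in> sets (?M (\<lambda>p. A $$ p) p)"
    then have E: "\<And>p. p \<in> ?I \<Longrightarrow> E p \<in> sets borel" by simp
    note likelihood_measurable[measurable]
    have "emeasure ?R (Pi\<^sub>E ?I E)
        = (\<integral>\<^sup>+x. ennreal (likelihood n sd A x) * indicator (Pi\<^sub>E ?I E) x \<partial>lebesgue_entries n)"
      by (intro emeasure_density) (auto simp: E intro!: sets_PiM_I_finite)
    also have "\<dots> = (\<integral>\<^sup>+x. (\<Prod>p\<in>?I. ennreal (normal_density (A $$ p) (s p) (x p)) * indicator (E p) (x p)) \<partial>lebesgue_entries n)"
    proof (intro nn_integral_cong)
      fix x assume x: "x \<in> space (lebesgue_entries n)"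
      have "indicator (Pi\<^sub>E ?I E) x = (\<Prod>p\<in>?I. indicator (E p) (x p) :: ennreal)"
      proof (cases "x \<in> Pi\<^sub>E ?I E")
        case True then have "(\<Prod>p\<in>?I. indicator (E p) (x p) :: ennreal) = 1"
          by (intro prod.neutral) (auto simp: PiE_iff)
        with True show ?thesis by simp
      next
        case False
        then obtain p where "p \<in> ?I" "x p \<notin> E p" using x by (auto simp: PiE_iff space_PiM)
        then have "(\<Prod>p\<in>?I. indicator (E p) (x p) :: ennreal) = 0"
          by (intro prod_zero bexI[of _ p]) auto
        with False show ?thesis by simp
      qed
      moreover have "ennreal (likelihood n sd A x) = (\<Prod>p\<in>?I. ennreal (normal_density (A $$ p) (s p) (x p)))"
        unfolding likelihood_def by (subst prod_ennreal[symmetric]) (auto simp: s_def intro!: prod.cong)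
      ultimately show "ennreal (likelihood n sd A x) * indicator (Pi\<^sub>E ?I E) x
        = (\<Prod>p\<in>?I. ennreal (normal_density (A $$ p) (s p) (x p)) * indicator (E p) (x p))"
        by (simp add: prod.distrib)
    qed
    also have "\<dots> = (\<Prod>p\<in>?I. \<integral>\<^sup>+x. ennreal (normal_density (A $$ p) (s p) x) * indicator (E p) x \<partial>lborel)"
      by (rule B.product_nn_integral_prod)
         (auto intro!: borel_measurable_times_ennreal borel_measurable_indicator E measurable_compose[OF borel_measurable_normal_density])
    also have "\<dots> = (\<Prod>p\<in>?I. emeasure (?M (\<lambda>p. A $$ p) p) (E p))"
      by (intro prod.cong refl emeasure_density[symmetric]) (auto simp: E)
    finally show "emeasure ?R (Pi\<^sub>E ?I E) = (\<Prod>p\<in>?I. emeasure (?M (\<lambda>p. A $$ p) p) (E p))" .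
  qed auto
  from L R show ?thesis by simp
qed

lemma measurable_translate_entries:
  "(\<lambda>h. \<lambda>p\<in>{..<n} \<times> {..<n}. A $$ p + h p) \<in> measurable (noise_law n sd) (entry_space n)"
proof -
  have "sets (noise_law n sd) = sets (entry_space n)"
    unfolding noise_law_def entry_space_def
    by (intro sets_PiM_cong) (auto simp: centered_normal_def split: if_splits)
  moreover have "(\<lambda>h. \<lambda>p\<in>{..<n} \<times> {..<n}. A $$ p + h p) \<in> measurable (entry_space n) (entry_space n)"
    unfolding entry_space_def by measurable
  ultimately show ?thesis by (simp cong: measurable_cong_sets)
qed

lemma add_noise_mat:
  assumes "A \<in> carrier_mat n n"
  shows "A + mat n n h = mat n n (\<lambda>p\<in>{..<n} \<times> {..<n}. A $$ p + h p)"
  using assms by (intro eq_matI) auto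

lemma borel_measurable_translated_noise:
  fixes L :: "real mat \<Rightarrow> ennreal"
  assumes "A \<in> carrier_mat n n" "(\<lambda>h. L (mat n n h)) \<in> borel_measurable (entry_space n)"
  shows "(\<lambda>h. L (A + mat n n h)) \<in> borel_measurable (noise_law n sd)"
  unfolding add_noise_mat[OF assms(1)]
  by (rule measurable_compose[OF measurable_translate_entries assms(2)])

lemma nn_integral_translated_noise:
  assumes sd: "\<And>i j. i < n \<Longrightarrow> j < n \<Longrightarrow> sd i j \<noteq> 0"
    and A: "A \<in> carrier_mat n n"
    and L: "(\<lambda>h. L (mat n n h)) \<in> borel_measurable (entry_space n)"
  shows "(\<integral>\<^sup>+h. L (A + mat n n h) \<partial>noise_law n sd)
    = (\<integral>\<^sup>+x. ennreal (likelihood n sd A x) * L (mat n n x) \<partial>lebesgue_entries n)"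
proof -
  let ?T = "\<lambda>h. \<lambda>p\<in>{..<n} \<times> {..<n}. A $$ p + h p"
  have "(\<integral>\<^sup>+h. L (A + mat n n h) \<partial>noise_law n sd) = (\<integral>\<^sup>+h. L (mat n n (?T h)) \<partial>noise_law n sd)"
    by (simp only: add_noise_mat[OF A])
  also have "\<dots> = (\<integral>\<^sup>+x. L (mat n n x) \<partial>distr (noise_law n sd) (entry_space n) ?T)"
    by (rule nn_integral_distr[symmetric])
       (use L measurable_translate_entries in \<open>simp_all only: measurable_distr_eq1\<close>)
  also have "\<dots> = (\<integral>\<^sup>+x. ennreal (likelihood n sd A x) * L (mat n n x) \<partial>lebesgue_entries n)"
    by (subst noise_law_translate, use sd in blast, rule nn_integral_density)
       (use L likelihood_measurable in \<open>auto cong: measurable_cong_sets simp: measurable_cong_sets[OF sets_lebesgue_entries refl]\<close>)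
  finally show ?thesis .
qed

lemma nn_integral_likelihood:
  assumes sd: "\<And>i j. i < n \<Longrightarrow> j < n \<Longrightarrow> sd i j \<noteq> 0"
  shows "(\<integral>\<^sup>+x. ennreal (likelihood n sd A x) \<partial>lebesgue_entries n) = 1"
proof -
  interpret B: product_sigma_finite "\<lambda>_. lborel :: real measure" by standard
  have "(\<integral>\<^sup>+x. ennreal (likelihood n sd A x) \<partial>lebesgue_entries n)
     = (\<integral>\<^sup>+x. (\<Prod>p\<in>{..<n} \<times> {..<n}. ennreal (normal_density (A $$ p) (case_prod sd p) (x p))) \<partial>lebesgue_entries n)"
    unfolding likelihood_def by (subst prod_ennreal) auto
  also have "\<dots> = (\<Prod>p\<in>{..<n} \<times> {..<n}. \<integral>\<^sup>+x. ennreal (normal_density (A $$ p) (case_prod sd p) x) \<partial>lborel)"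
    by (rule B.product_nn_integral_prod) auto
  also have "\<dots> = 1"
  proof (intro prod.neutral ballI)
    fix p assume "p \<in> {..<n} \<times> {..<n}"
    then have "case_prod sd p \<noteq> 0" using sd by auto
    from prob_space.emeasure_space_1[OF prob_space_gauss[OF this, of "A $$ p"]]
    show "(\<integral>\<^sup>+x. ennreal (normal_density (A $$ p) (case_prod sd p) x) \<partial>lborel) = 1"
      by (simp add: emeasure_density)
  qed
  finally show ?thesis .
qed

lemma sqrt_prod: "sqrt (\<Prod>p\<in>I. f p) = (\<Prod>p\<in>I. sqrt (f p))"
  by (induct I rule: infinite_finite_induct) (auto simp: real_sqrt_mult)

text \<open>
  The affinity of product measures is the product of the affinities of the factors.
\<close>

lemma likelihood_affinity:
  assumes sd: "\<And>i j. i < n \<Longrightarrow> j < n \<Longrightarrow> sd i j \<noteq> 0"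
  shows "(\<integral>\<^sup>+x. ennreal (sqrt (likelihood n sd A x * likelihood n sd B x)) \<partial>lebesgue_entries n)
    = ennreal (exp (- (\<Sum>p\<in>{..<n} \<times> {..<n}. (A $$ p - B $$ p)\<^sup>2 / (8 * (case_prod sd p)\<^sup>2))))"
proof -
  let ?I = "{..<n} \<times> {..<n}"
  let ?c = "\<lambda>p. exp (- (A $$ p - B $$ p)\<^sup>2 / (8 * (case_prod sd p)\<^sup>2))"
  let ?m = "mat n n (\<lambda>p. (A $$ p + B $$ p) / 2)"
  have "sqrt (likelihood n sd A x * likelihood n sd B x) = (\<Prod>p\<in>?I. ?c p) * likelihood n sd ?m x" for x
  proof -
    have "sqrt (likelihood n sd A x * likelihood n sd B x)
       = (\<Prod>p\<in>?I. sqrt (normal_density (A $$ p) (case_prod sd p) (x p) * normal_density (B $$ p) (case_prod sd p) (x p)))"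
      unfolding likelihood_def prod.distrib[symmetric]
      by (rule sqrt_prod)
    also have "\<dots> = (\<Prod>p\<in>?I. ?c p * normal_density (?m $$ p) (case_prod sd p) (x p))"
      by (intro prod.cong refl) (auto simp only: sqrt_normal_density_mult, auto)
    finally show ?thesis unfolding likelihood_def by (simp add: prod.distrib)
  qed
  then have "(\<integral>\<^sup>+x. ennreal (sqrt (likelihood n sd A x * likelihood n sd B x)) \<partial>lebesgue_entries n)
     = (\<integral>\<^sup>+x. ennreal (\<Prod>p\<in>?I. ?c p) * ennreal (likelihood n sd ?m x) \<partial>lebesgue_entries n)"
    by (simp add: ennreal_mult prod_nonneg likelihood_nonneg)
  also have "\<dots> = ennreal (\<Prod>p\<in>?I. ?c p) * 1"
    using likelihood_measurable
    by (subst nn_integral_cmult) (auto simp: nn_integral_likelihood[OF sd])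
  also have "(\<Prod>p\<in>?I. ?c p) = exp (\<Sum>p\<in>?I. - (A $$ p - B $$ p)\<^sup>2 / (8 * (case_prod sd p)\<^sup>2))"
    by (simp add: exp_sum)
  also have "(\<Sum>p\<in>?I. - (A $$ p - B $$ p)\<^sup>2 / (8 * (case_prod sd p)\<^sup>2))
     = - (\<Sum>p\<in>?I. (A $$ p - B $$ p)\<^sup>2 / (8 * (case_prod sd p)\<^sup>2))"
    by (simp add: sum_negf)
  finally show ?thesis by simp
qed

text \<open>
  Two densities of total mass one each whose geometric mean has mass close to one must overlap:
  integrating this inequality bounds the mass of the minimum from below by the affinity.
\<close>

lemma min_ge_geometric_mean:
  fixes p q :: real
  assumes "0 \<le> p" "0 \<le> q"
  shows "14 / 5 * sqrt (p * q) \<le> min p q + p + q"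
proof -
  \<comment> \<open>The constant must not exceed \<open>2 * sqrt 2\<close>, the arithmetic-geometric mean bound.\<close>
  have *: "14 / 5 * (a * b) \<le> 2 * a\<^sup>2 + b\<^sup>2" for a b :: real
  proof -
    have "0 \<le> (b - 7 / 5 * a)\<^sup>2 + (a / 5)\<^sup>2" by simp
    also have "\<dots> = 2 * a\<^sup>2 + b\<^sup>2 - 14 / 5 * (a * b)" by (simp add: power2_eq_square field_simps)
    finally show ?thesis by simp
  qed
  from *[of "sqrt p" "sqrt q"] *[of "sqrt q" "sqrt p"] assms show ?thesis
    by (simp add: real_sqrt_mult min_def mult.commute)
qed

lemma sd_nonzero:
  fixes smin :: real and sd :: "nat \<Rightarrow> nat \<Rightarrow> real"
  assumes "0 < smin" "\<forall>i<n. \<forall>j<n. (sd i j)\<^sup>2 \<ge> smin\<^sup>2" "i < n" "j < n"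
  shows "sd i j \<noteq> 0"
proof
  assume "sd i j = 0"
  moreover have "smin\<^sup>2 \<le> (sd i j)\<^sup>2" using assms(2-4) by blast
  ultimately have "smin\<^sup>2 \<le> 0" by (simp only: power_zero_numeral)
  then show False using assms(1) by simp
qed

text \<open>
  Signals at distance at most \<open>smin / 2\<close> have affinity at least \<open>exp (- 1 / 32)\<close>, because every entry carries
  noise of standard deviation at least \<open>smin\<close>; the common part of their likelihoods then has mass at
  least one half.
\<close>

lemma likelihood_overlap:
  assumes s: "0 < smin" "\<forall>i<n. \<forall>j<n. (sd i j)\<^sup>2 \<ge> smin\<^sup>2"
    and AB: "A \<in> carrier_mat n n" "B \<in> carrier_mat n n"
    and close: "frob_norm (A - B) \<le> smin / 2"
  shows "1 / 2 \<le> (\<integral>\<^sup>+x. ennreal (min (likelihood n sd A x) (likelihood n sd B x)) \<partial>lebesgue_entries n)"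
    (is "_ \<le> ?m")
proof -
  let ?I = "{..<n} \<times> {..<n}" and ?p = "likelihood n sd A" and ?q = "likelihood n sd B"
  note likelihood_measurable[measurable]
  note sd = sd_nonzero[OF s]
  have "(frob_norm (A - B))\<^sup>2 = (\<Sum>p\<in>?I. (A $$ p - B $$ p)\<^sup>2)"
    using AB unfolding frob_norm_def sum.cartesian_product
    by (subst real_sqrt_pow2) (auto intro!: sum_nonneg sum.cong)
  moreover have "(frob_norm (A - B))\<^sup>2 \<le> (smin / 2)\<^sup>2"
    using close by (intro power_mono) (auto simp: frob_norm_def intro!: sum_nonneg)
  ultimately have d: "(\<Sum>p\<in>?I. (A $$ p - B $$ p)\<^sup>2) \<le> smin\<^sup>2 / 4"
    by (simp add: power_divide)
  have "(\<Sum>p\<in>?I. (A $$ p - B $$ p)\<^sup>2 / (8 * (case_prod sd p)\<^sup>2))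
      \<le> (\<Sum>p\<in>?I. (A $$ p - B $$ p)\<^sup>2 / (8 * smin\<^sup>2))"
    using s by (intro sum_mono divide_left_mono mult_pos_pos) (auto simp: sd)
  also have "\<dots> = (\<Sum>p\<in>?I. (A $$ p - B $$ p)\<^sup>2) / (8 * smin\<^sup>2)"
    by (simp add: sum_divide_distrib)
  also have "\<dots> \<le> 1 / 32" using d s(1) by (simp add: field_simps)
  finally have "exp (- (1 / 32)) \<le> exp (- (\<Sum>p\<in>?I. (A $$ p - B $$ p)\<^sup>2 / (8 * (case_prod sd p)\<^sup>2)))"
    by simp
  moreover have "(31 / 32 :: real) \<le> exp (- (1 / 32))"
    using exp_ge_add_one_self[of "- (1 / 32) :: real"] by simp
  ultimately have e: "5 / 2 \<le> 14 / 5 * exp (- (\<Sum>p\<in>?I. (A $$ p - B $$ p)\<^sup>2 / (8 * (case_prod sd p)\<^sup>2)))"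
    by linarith
  have "ennreal (5 / 2) \<le> ennreal (14 / 5) * (\<integral>\<^sup>+x. ennreal (sqrt (?p x * ?q x)) \<partial>lebesgue_entries n)"
    using e by (subst likelihood_affinity, use sd in blast, subst ennreal_mult'[symmetric]) (auto intro!: ennreal_leI)
  also have "\<dots> = (\<integral>\<^sup>+x. ennreal (14 / 5 * sqrt (?p x * ?q x)) \<partial>lebesgue_entries n)"
    by (subst nn_integral_cmult[symmetric], simp, intro nn_integral_cong)
       (subst ennreal_mult, auto simp: likelihood_nonneg)
  also have "\<dots> \<le> (\<integral>\<^sup>+x. ennreal (min (?p x) (?q x)) + ennreal (?p x) + ennreal (?q x) \<partial>lebesgue_entries n)"
  proof (intro nn_integral_mono)
    fix x
    have "ennreal (14 / 5 * sqrt (?p x * ?q x)) \<le> ennreal (min (?p x) (?q x) + ?p x + ?q x)"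
      by (intro ennreal_leI min_ge_geometric_mean likelihood_nonneg)
    then show "ennreal (14 / 5 * sqrt (?p x * ?q x))
        \<le> ennreal (min (?p x) (?q x)) + ennreal (?p x) + ennreal (?q x)"
      by (simp add: likelihood_nonneg)
  qed
  also have "\<dots> = ?m + 1 + 1"
    by (simp add: nn_integral_add nn_integral_likelihood[OF sd])
  finally have le: "ennreal (5 / 2) \<le> ?m + 2" by (simp add: add.assoc)
  show ?thesis
  proof (cases ?m)
    case (real t)
    have "ennreal (5 / 2) \<le> ennreal (t + 2)" using le real ennreal_plus[of t 2] by simp
    then have "1 / 2 \<le> t" using real by (subst (asm) ennreal_le_iff) auto
    then have "ennreal (1 / 2) \<le> ?m" unfolding real(2) by (rule ennreal_leI)
    moreover have "ennreal (1 / 2) = 1 / 2" using ennreal_divide_numeral[of 1 "num.Bit0 num.One"] by simp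
    ultimately show ?thesis by simp
  qed (simp add: top_greatest)
qed

section \<open>Risk bounds from indistinguishable signals\<close>

text \<open>
  Le Cam's two-point method: on the common part of the two likelihoods the observation carries no
  information about which signal is present, and there the two losses add up to at least \<open>D\<close>.
\<close>

lemma two_point_risk_bound:
  fixes L1 L2 :: "real mat \<Rightarrow> ennreal"
  assumes s: "0 < smin" "\<forall>i<n. \<forall>j<n. (sd i j)\<^sup>2 \<ge> smin\<^sup>2"
    and AB: "A \<in> carrier_mat n n" "B \<in> carrier_mat n n"
    and close: "frob_norm (A - B) \<le> smin / 2"
    and L1: "(\<lambda>h. L1 (mat n n h)) \<in> borel_measurable (entry_space n)"
    and L2: "(\<lambda>h. L2 (mat n n h)) \<in> borel_measurable (entry_space n)"
    and D: "\<And>X. X \<in> carrier_mat n n \<Longrightarrow> D \<le> L1 X + L2 X"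
  shows "D / 2 \<le> (\<integral>\<^sup>+h. L1 (A + mat n n h) \<partial>noise_law n sd) + (\<integral>\<^sup>+h. L2 (B + mat n n h) \<partial>noise_law n sd)"
proof -
  let ?p = "likelihood n sd A" and ?q = "likelihood n sd B"
  note likelihood_measurable[measurable]
  have [measurable]: "(\<lambda>h. L1 (mat n n h)) \<in> borel_measurable (lebesgue_entries n)"
    "(\<lambda>h. L2 (mat n n h)) \<in> borel_measurable (lebesgue_entries n)"
    using L1 L2 by (simp_all add: measurable_cong_sets[OF sets_lebesgue_entries refl])
  note sd = sd_nonzero[OF s]
  have "D / 2 = D * (1 / 2)" by (simp add: ennreal_times_divide)
  also have "\<dots> \<le> D * (\<integral>\<^sup>+x. ennreal (min (?p x) (?q x)) \<partial>lebesgue_entries n)"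
    by (intro mult_left_mono likelihood_overlap[OF s AB close]) auto
  also have "\<dots> = (\<integral>\<^sup>+x. ennreal (min (?p x) (?q x)) * D \<partial>lebesgue_entries n)"
    by (subst nn_integral_multc) (auto simp: mult.commute)
  also have "\<dots> \<le> (\<integral>\<^sup>+x. ennreal (?p x) * L1 (mat n n x) + ennreal (?q x) * L2 (mat n n x) \<partial>lebesgue_entries n)"
  proof (intro nn_integral_mono)
    fix x
    have "ennreal (min (?p x) (?q x)) * D
        \<le> ennreal (min (?p x) (?q x)) * L1 (mat n n x) + ennreal (min (?p x) (?q x)) * L2 (mat n n x)"
      unfolding distrib_left[symmetric] by (intro mult_left_mono D) auto
    also have "\<dots> \<le> ennreal (?p x) * L1 (mat n n x) + ennreal (?q x) * L2 (mat n n x)"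
      by (intro add_mono mult_right_mono ennreal_leI) auto
    finally show "ennreal (min (?p x) (?q x)) * D \<le> \<dots>" .
  qed
  also have "\<dots> = (\<integral>\<^sup>+x. ennreal (?p x) * L1 (mat n n x) \<partial>lebesgue_entries n)
      + (\<integral>\<^sup>+x. ennreal (?q x) * L2 (mat n n x) \<partial>lebesgue_entries n)"
    by (rule nn_integral_add) auto
  finally show ?thesis
    by (simp only: nn_integral_translated_noise[OF sd AB(1) L1] nn_integral_translated_noise[OF sd AB(2) L2])
qed

lemma lin_loss_measurable:
  assumes "f \<in> scalar_estimators n"
  shows "(\<lambda>h. ennreal (min_pm (f (mat n n h)) t)) \<in> borel_measurable (entry_space n)"
proof -
  have [measurable]: "(\<lambda>h. f (mat n n h)) \<in> borel_measurable (entry_space n)"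
    using assms by (simp add: scalar_estimators_def)
  show ?thesis unfolding min_pm_eq by measurable
qed

lemma vec_estimator_coord_measurable:
  assumes "f \<in> vec_estimators n" "i < n"
  shows "(\<lambda>h. f (mat n n h) $ i) \<in> borel_measurable (entry_space n)"
  using assms by (simp add: vec_estimators_def scalar_estimators_def)

lemma vec_loss_measurable:
  assumes f: "f \<in> vec_estimators n" and v: "v \<in> carrier_vec n"
  shows "(\<lambda>h. ennreal (min_pm_vec (f (mat n n h)) v)) \<in> borel_measurable (entry_space n)"
proof -
  have d: "f (mat n n h) \<in> carrier_vec n" for h using f by (simp add: vec_estimators_def)
  have e: "norm2 (f (mat n n h) - w) = sqrt (\<Sum>i<n. (f (mat n n h) $ i - w $ i)\<^sup>2)"
    if "w \<in> carrier_vec n" for h w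
    unfolding norm2_eq_L2 L2_set_def using d[of h] that by (intro arg_cong[where f=sqrt] sum.cong) auto
  have m: "(\<lambda>h. norm2 (f (mat n n h) - w)) \<in> borel_measurable (entry_space n)" if "w \<in> carrier_vec n" for w
  proof -
    have "(\<lambda>h. \<Sum>i<n. (f (mat n n h) $ i - w $ i)\<^sup>2) \<in> borel_measurable (entry_space n)"
      using vec_estimator_coord_measurable[OF f]
      by (intro borel_measurable_sum borel_measurable_power borel_measurable_diff) auto
    then show ?thesis unfolding e[OF that] by measurable
  qed
  show ?thesis
    unfolding min_pm_vec_eq[OF d v]
    using m[OF v] m[of "- v"] v by simp
qed

lemma ennreal_quarter_le:
  assumes "ennreal d / 2 \<le> x + y" "x \<le> z" "y \<le> z" "0 \<le> d"
  shows "ennreal (d / 4) \<le> z"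
proof (cases z)
  case (real r)
  have "ennreal (d / 2) = ennreal d / 2" using assms(4) ennreal_divide_numeral[of d "num.Bit0 num.One"] by simp
  also have "\<dots> \<le> z + z" using assms(1-3) add_mono order_trans by blast
  also have "z + z = ennreal (r + r)" using real by (simp only: ennreal_plus)
  finally have "d / 2 \<le> r + r" using real by (subst (asm) ennreal_le_iff) auto
  then show ?thesis using real by (auto intro!: ennreal_leI)
qed simp

lemma lin_minimax_two_points:
  assumes s: "0 < smin" "\<forall>i<n. \<forall>j<n. (sd i j)\<^sup>2 \<ge> smin\<^sup>2"
    and AB: "A \<in> \<A>" "B \<in> \<A>" "A \<in> carrier_mat n n" "B \<in> carrier_mat n n"
    and close: "frob_norm (A - B) \<le> smin / 2"
  shows "ennreal (min_pm (a \<bullet> nth_eigenvector l A) (a \<bullet> nth_eigenvector l B) / 4) \<le> lin_minimax n sd l a \<A>"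
  unfolding lin_minimax_def
proof (rule INF_greatest)
  fix f assume f: "f \<in> scalar_estimators n"
  let ?t = "\<lambda>A. a \<bullet> nth_eigenvector l A"
  have "ennreal (min_pm (?t A) (?t B)) / 2 \<le> lin_risk n sd l a f A + lin_risk n sd l a f B"
    unfolding lin_risk_def
  proof (rule two_point_risk_bound[OF s AB(3,4) close lin_loss_measurable[OF f] lin_loss_measurable[OF f]])
    fix X
    show "ennreal (min_pm (?t A) (?t B)) \<le> ennreal (min_pm (f X) (?t A)) + ennreal (min_pm (f X) (?t B))"
      using min_pm_triangle[of "?t A" "?t B" "f X"]
      by (simp add: min_pm_eq ennreal_leI flip: ennreal_plus)
  qed
  then show "ennreal (min_pm (?t A) (?t B) / 4) \<le> (SUP A\<in>\<A>. lin_risk n sd l a f A)"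
    by (rule ennreal_quarter_le) (auto intro: SUP_upper AB simp: min_pm_eq)
qed

lemma vec_minimax_two_points:
  assumes s: "0 < smin" "\<forall>i<n. \<forall>j<n. (sd i j)\<^sup>2 \<ge> smin\<^sup>2"
    and AB: "A \<in> \<A>" "B \<in> \<A>" "A \<in> carrier_mat n n" "B \<in> carrier_mat n n"
    and ev: "nth_eigenvector l A \<in> carrier_vec n" "nth_eigenvector l B \<in> carrier_vec n"
    and close: "frob_norm (A - B) \<le> smin / 2"
  shows "ennreal (min_pm_vec (nth_eigenvector l A) (nth_eigenvector l B) / 4) \<le> vec_minimax n sd l \<A>"
  unfolding vec_minimax_def
proof (rule INF_greatest)
  fix f assume f: "f \<in> vec_estimators n"
  let ?t = "\<lambda>A. nth_eigenvector l A"
  have "ennreal (min_pm_vec (?t A) (?t B)) / 2 \<le> vec_risk n sd l f A + vec_risk n sd l f B"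
    unfolding vec_risk_def
  proof (rule two_point_risk_bound[OF s AB(3,4) close vec_loss_measurable[OF f ev(1)] vec_loss_measurable[OF f ev(2)]])
    fix X :: "real mat" assume "X \<in> carrier_mat n n"
    then have "f X \<in> carrier_vec n" using f by (simp add: vec_estimators_def)
    from min_pm_vec_triangle[OF ev this]
    show "ennreal (min_pm_vec (?t A) (?t B)) \<le> ennreal (min_pm_vec (f X) (?t A)) + ennreal (min_pm_vec (f X) (?t B))"
      by (simp add: min_pm_vec_nonneg ennreal_leI flip: ennreal_plus)
  qed
  then show "ennreal (min_pm_vec (?t A) (?t B) / 4) \<le> (SUP A\<in>\<A>. vec_risk n sd l f A)"
    by (rule ennreal_quarter_le) (auto intro: SUP_upper AB simp: min_pm_vec_nonneg)
qed

lemma sum_Pow_split: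
  fixes g :: "nat set \<Rightarrow> 'a::comm_monoid_add"
  assumes "finite I" "i \<in> I"
  shows "(\<Sum>S\<in>Pow I. g S) = (\<Sum>S\<in>Pow (I - {i}). g S + g (insert i S))"
proof -
  have "Pow I = Pow (I - {i}) \<union> insert i ` Pow (I - {i})"
    using assms(2) Pow_insert[of i "I - {i}"] by (simp add: insert_absorb)
  moreover have "Pow (I - {i}) \<inter> insert i ` Pow (I - {i}) = {}" by auto
  moreover have "inj_on (insert i) (Pow (I - {i}))" by (auto simp: inj_on_def)
  ultimately show ?thesis
    using assms(1) by (simp add: sum.union_disjoint sum.reindex sum.distrib)
qed

text \<open>
  Assouad's method for signals indexed by the vertices of a hypercube, where the loss counts the
  wrongly guessed coordinates and neighbouring vertices are indistinguishable. The worst vertex is at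
  least as bad as the average one, and the average splits into two-point problems along the edges.
\<close>

lemma hypercube_risk_bound:
  fixes A :: "nat set \<Rightarrow> real mat" and L :: "nat set \<Rightarrow> real mat \<Rightarrow> ennreal"
  assumes s: "0 < smin" "\<forall>i<n. \<forall>j<n. (sd i j)\<^sup>2 \<ge> smin\<^sup>2"
    and A: "\<And>S. S \<subseteq> {..<d} \<Longrightarrow> A S \<in> carrier_mat n n"
    and close: "\<And>S i. S \<subseteq> {..<d} \<Longrightarrow> i < d \<Longrightarrow> i \<notin> S \<Longrightarrow> frob_norm (A S - A (insert i S)) \<le> smin / 2"
    and d: "0 < d" and t: "0 \<le> t"
    and meas: "\<And>i. i < d \<Longrightarrow> Measurable.pred (entry_space n) (\<lambda>h. \<eta> (mat n n h) i)"
    and loss: "\<And>S X. S \<subseteq> {..<d} \<Longrightarrow> X \<in> carrier_mat n n \<Longrightarrow>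
        ennreal (t * real (card {i\<in>{..<d}. \<eta> X i \<noteq> (i \<in> S)})) \<le> L S X"
  shows "ennreal (t * real d / 4) \<le> (SUP S\<in>Pow {..<d}. \<integral>\<^sup>+h. L S (A S + mat n n h) \<partial>noise_law n sd)"
proof -
  define w :: "nat set \<Rightarrow> nat \<Rightarrow> real mat \<Rightarrow> ennreal" where "w S i X = of_bool (\<eta> X i \<noteq> (i \<in> S))" for S i X
  define p where "p S i = (\<integral>\<^sup>+h. w S i (A S + mat n n h) \<partial>noise_law n sd)" for S i
  let ?x = "SUP S\<in>Pow {..<d}. \<integral>\<^sup>+h. L S (A S + mat n n h) \<partial>noise_law n sd"
  have wm: "(\<lambda>h. w S i (mat n n h)) \<in> borel_measurable (entry_space n)" if "i < d" for S i
  proof -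
    note meas[OF that, measurable]
    show ?thesis unfolding w_def by (cases "i \<in> S") (simp_all, measurable)
  qed
  have pair: "1 / 2 \<le> p S i + p (insert i S) i" if "S \<subseteq> {..<d}" "i < d" "i \<notin> S" for S i
    unfolding p_def
    by (rule two_point_risk_bound[OF s A A close wm wm]) (use that in \<open>auto simp: w_def\<close>)
  have risk: "ennreal t * (\<Sum>i<d. p S i) \<le> ?x" if S: "S \<in> Pow {..<d}" for S
  proof -
    have wm': "(\<lambda>h. w S i (A S + mat n n h)) \<in> borel_measurable (noise_law n sd)" if "i < d" for i
      using S by (intro borel_measurable_translated_noise A wm that) auto
    have "ennreal t * (\<Sum>i<d. p S i) = ennreal t * (\<integral>\<^sup>+h. (\<Sum>i<d. w S i (A S + mat n n h)) \<partial>noise_law n sd)"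
      unfolding p_def by (subst nn_integral_sum) (auto intro: wm')
    also have "\<dots> = (\<integral>\<^sup>+h. ennreal t * (\<Sum>i<d. w S i (A S + mat n n h)) \<partial>noise_law n sd)"
      by (rule nn_integral_cmult[symmetric]) (auto intro!: borel_measurable_sum wm')
    also have "\<dots> \<le> (\<integral>\<^sup>+h. L S (A S + mat n n h) \<partial>noise_law n sd)"
    proof (rule nn_integral_mono)
      fix h
      let ?X = "A S + mat n n h"
      have "(\<Sum>i<d. w S i ?X) = of_nat (card {i\<in>{..<d}. \<eta> ?X i \<noteq> (i \<in> S)})"
        unfolding w_def by (subst sum_of_bool_eq) (auto intro!: arg_cong[where f=card])
      then have "ennreal t * (\<Sum>i<d. w S i ?X) = ennreal (t * real (card {i\<in>{..<d}. \<eta> ?X i \<noteq> (i \<in> S)}))"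
        using t by (simp add: ennreal_mult ennreal_of_nat_eq_real_of_nat)
      also have "\<dots> \<le> L S ?X" using S by (intro loss) (auto intro: A)
      finally show "ennreal t * (\<Sum>i<d. w S i ?X) \<le> L S ?X" .
    qed
    also have "\<dots> \<le> ?x" using S by (intro SUP_upper)
    finally show ?thesis .
  qed
  \<comment> \<open>Neighbouring vertices are indistinguishable, so coordinate \<open>i\<close> is guessed wrongly with total
      probability at least one half on every edge in direction \<open>i\<close>.\<close>
  have half: "of_nat (2 ^ (d - 1)) * (1 / 2) \<le> (\<Sum>S\<in>Pow {..<d}. p S i)" if "i < d" for i
  proof -
    have "of_nat (2 ^ (d - 1)) * (1 / 2) = (\<Sum>S\<in>Pow ({..<d} - {i}). 1 / 2 :: ennreal)"
      using that by (simp add: card_Pow)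
    also have "\<dots> \<le> (\<Sum>S\<in>Pow ({..<d} - {i}). p S i + p (insert i S) i)"
      using that by (intro sum_mono pair) auto
    also have "\<dots> = (\<Sum>S\<in>Pow {..<d}. p S i)" using that by (subst sum_Pow_split[of _ i]) auto
    finally show ?thesis .
  qed
  have "ennreal t * (of_nat d * (of_nat (2 ^ (d - 1)) * (1 / 2)))
      = ennreal t * (\<Sum>i<d. of_nat (2 ^ (d - 1)) * (1 / 2))" by simp
  also have "\<dots> \<le> ennreal t * (\<Sum>i<d. \<Sum>S\<in>Pow {..<d}. p S i)"
    by (intro mult_left_mono sum_mono half) auto
  also have "\<dots> = (\<Sum>S\<in>Pow {..<d}. ennreal t * (\<Sum>i<d. p S i))"
    unfolding sum_distrib_left[symmetric] by (subst sum.swap) simp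
  also have "\<dots> \<le> (\<Sum>S\<in>Pow {..<d}. ?x)" by (intro sum_mono risk)
  also have "\<dots> = of_nat (2 ^ d) * ?x" by (simp add: card_Pow)
  finally have main: "ennreal t * (of_nat d * (of_nat (2 ^ (d - 1)) * (1 / 2))) \<le> of_nat (2 ^ d) * ?x" .
  show ?thesis
  proof (cases ?x)
    case (real r)
    have h: "(1 / 2 :: ennreal) = ennreal (1 / 2)" using ennreal_divide_numeral[of 1 "num.Bit0 num.One"] by simp
    have "ennreal (t * (real d * (real (2 ^ (d - 1)) * (1 / 2)))) = ennreal t * (of_nat d * (of_nat (2 ^ (d - 1)) * (1 / 2)))"
      using t unfolding h ennreal_of_nat_eq_real_of_nat
      by (simp only: ennreal_mult of_nat_0_le_iff mult_nonneg_nonneg zero_le_divide_1_iff zero_le_numeral)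
    also have "\<dots> \<le> of_nat (2 ^ d) * ennreal r" using main unfolding real(2) .
    also have "\<dots> = ennreal (real (2 ^ d) * r)"
      using real unfolding ennreal_of_nat_eq_real_of_nat by (simp only: ennreal_mult of_nat_0_le_iff)
    finally have "t * (real d * (real (2 ^ (d - 1)) * (1 / 2))) \<le> real (2 ^ d) * r"
      using real by (subst (asm) ennreal_le_iff) auto
    moreover have "real (2 ^ d) = 2 * real (2 ^ (d - 1))" using d by (cases d) auto
    ultimately have "real (2 ^ (d - 1)) * (t * real d / 2) \<le> real (2 ^ (d - 1)) * (2 * r)" by (simp add: field_simps)
    then have "t * real d / 2 \<le> 2 * r" by (simp add: mult_le_cancel_left_pos)
    then show ?thesis unfolding real(2) by (intro ennreal_leI) simp
  next
    case top
    show ?thesis unfolding top by (rule top_greatest)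
  qed
qed

section \<open>Bounds from planar rotations\<close>

text \<open>
  The tilted eigenvector has the linear form \<open>c * \<alpha> + s * \<beta>\<close>. Its absolute value can agree with
  \<open>\<bar>\<alpha>\<bar>\<close> for one direction of the tilt, where the second-order and the first-order change cancel, but then
  not for the opposite direction. Hence the target is compared with both tilts.
\<close>

lemma three_angles:
  fixes \<alpha> \<beta> c s :: real
  assumes cs: "c\<^sup>2 + s\<^sup>2 = 1" and c: "0 \<le> c" and s: "0 \<le> s" "s \<le> 1 / 8"
  shows "\<exists>\<sigma>\<in>{s, - s}. (\<bar>\<alpha>\<bar> * s\<^sup>2 + \<bar>\<beta>\<bar> * s) / 2 \<le> min_pm (c * \<alpha> + \<sigma> * \<beta>) \<alpha>"
proof -
  \<comment> \<open>One of the signs of \<open>s\<close> gives \<open>c * a + s * b\<close> in absolute value, the other \<open>\<bar>c * a - s * b\<bar>\<close>.\<close>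
  define a b where "a = \<bar>\<alpha>\<bar>" and "b = \<bar>\<beta>\<bar>"
  have ab: "0 \<le> a" "0 \<le> b" by (auto simp: a_def b_def)
  have s2: "s\<^sup>2 \<le> 1 / 64" using s power_mono[of s "1/8" 2] by (simp add: power_divide)
  then have "(3 / 4)\<^sup>2 \<le> c\<^sup>2" using cs by (simp add: power_divide)
  then have c34: "3 / 4 \<le> c" using c by (rule power2_le_imp_le)
  have "c\<^sup>2 \<le> 1" using cs zero_le_power2[of s] by linarith
  then have "c\<^sup>2 \<le> 1\<^sup>2" by simp
  then have c1: "c \<le> 1" by (rule power2_le_imp_le) simp
  have lo: "s\<^sup>2 / 2 \<le> 1 - c"
  proof -
    have "s\<^sup>2 = (1 - c) * (1 + c)" using cs by (simp add: power2_eq_square algebra_simps)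
    also have "\<dots> \<le> (1 - c) * 2" using c1 by (intro mult_left_mono) auto
    finally show ?thesis by simp
  qed
  have hi: "1 - c \<le> s\<^sup>2"
  proof -
    have "1 - c \<le> (1 - c) * (1 + c)" using c1 c mult_left_mono[of 1 "1 + c" "1 - c"] by simp
    also have "\<dots> = s\<^sup>2" using cs by (simp add: power2_eq_square algebra_simps)
    finally show ?thesis .
  qed
  obtain \<sigma>1 \<sigma>2 where sg: "\<sigma>1 \<in> {s, - s}" "\<sigma>2 \<in> {s, - s}"
    "\<bar>c * \<alpha> + \<sigma>1 * \<beta>\<bar> = c * a + s * b" "\<bar>c * \<alpha> + \<sigma>2 * \<beta>\<bar> = \<bar>c * a - s * b\<bar>"
  proof -
    have *: "\<bar>p + q\<bar> = \<bar>p\<bar> + \<bar>q\<bar> \<and> \<bar>p - q\<bar> = \<bar>\<bar>p\<bar> - \<bar>q\<bar>\<bar>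
        \<or> \<bar>p - q\<bar> = \<bar>p\<bar> + \<bar>q\<bar> \<and> \<bar>p + q\<bar> = \<bar>\<bar>p\<bar> - \<bar>q\<bar>\<bar>" for p q :: real
      by linarith
    have "\<bar>c * \<alpha>\<bar> = c * a" "\<bar>s * \<beta>\<bar> = s * b" using c s by (simp_all add: a_def b_def abs_mult)
    with *[of "c * \<alpha>" "s * \<beta>"] show ?thesis using that[of s "- s"] that[of "- s" s] by auto
  qed
  show ?thesis
  \<comment> \<open>If \<open>c * a\<close> dominates, the second-order loss \<open>a * (1 - c)\<close> and the first-order loss \<open>s * b\<close> add up
      for the inward tilt; otherwise \<open>s * b\<close> dominates and the outward tilt gains almost all of it.\<close>
  proof (cases "s * b \<le> c * a")
    case True
    have *: "(p + q) / 2 \<le> a - (d - q)" if "p / 2 \<le> a - d" "0 \<le> q" for p q d :: real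
      using that by (simp add: field_simps)
    have "a * (s\<^sup>2 / 2) \<le> a * (1 - c)" using lo ab(1) by (rule mult_left_mono)
    then have "a * s\<^sup>2 / 2 \<le> a - c * a" by (simp add: algebra_simps)
    moreover have "0 \<le> s * b" using s(1) ab(2) by (rule mult_nonneg_nonneg)
    ultimately have "(a * s\<^sup>2 + s * b) / 2 \<le> a - (c * a - s * b)" by (rule *)
    then have "(a * s\<^sup>2 + b * s) / 2 \<le> a - (c * a - s * b)" by (subst mult.commute[of b s])
    also have "\<dots> \<le> min_pm (c * \<alpha> + \<sigma>2 * \<beta>) \<alpha>"
      unfolding min_pm_eq sg(4) using True by (simp add: a_def)
    finally show ?thesis using sg(2) unfolding a_def b_def by blast
  next
    case False
    have *: "(p + q) / 2 \<le> q - x" if "x \<le> p" "p \<le> a / 64" "a * (3 / 4) \<le> q" for p q x :: real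
      using that ab(1) by (simp add: field_simps)
    have "a * (1 - c) \<le> a * s\<^sup>2" using hi ab(1) by (rule mult_left_mono)
    moreover have "a * s\<^sup>2 \<le> a / 64" using mult_left_mono[OF s2 ab(1)] by simp
    moreover have "a * (3 / 4) \<le> b * s"
      using False mult_right_mono[OF c34 ab(1)] by (simp add: mult.commute)
    ultimately have "(a * s\<^sup>2 + b * s) / 2 \<le> b * s - a * (1 - c)" by (rule *)
    also have "\<dots> = (c * a + s * b) - a" by (simp add: algebra_simps)
    also have "\<dots> \<le> min_pm (c * \<alpha> + \<sigma>1 * \<beta>) \<alpha>"
      unfolding min_pm_eq sg(3) by (simp add: a_def)
    finally show ?thesis using sg(1) unfolding a_def b_def by blast
  qed
qed

text \<open>
  The common setting of the two-point bounds: an eigenbasis \<open>e\<close>, padded by the eigenvalue \<open>0\<close> beyond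
  \<open>r\<close>, and a class of matrices that contains all small rotations of \<open>e l\<close> towards \<open>e k\<close>. Directions
  \<open>k \<le> r\<close> have the spectral gap \<open>\<bar>lam l - lam k\<bar>\<close>, directions in the kernel have the gap \<open>\<bar>lam l\<bar>\<close>.
\<close>

locale rotation_hypotheses =
  fixes n r l k :: nat and lam :: "nat \<Rightarrow> real" and e :: "nat \<Rightarrow> real vec"
    and sd :: "nat \<Rightarrow> nat \<Rightarrow> real" and smin g :: real and \<A> :: "real mat set"
  assumes smin: "0 < smin" and sd: "\<forall>i<n. \<forall>j<n. (sd i j)\<^sup>2 \<ge> smin\<^sup>2"
    and e: "orthonormal n n e" and r: "r \<le> n"
    and l: "l \<in> {1..r}" and k: "k \<in> {1..n}" "k \<noteq> l"
    and nz: "\<forall>j\<in>{1..r}. lam j \<noteq> 0"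
    and dec: "\<forall>i\<in>{1..r}. \<forall>j\<in>{1..r}. i \<le> j \<longrightarrow> lam j \<le> lam i"
    and simple: "\<forall>j\<in>{1..r} - {l}. lam j \<noteq> lam l"
    and g: "g = \<bar>lam l - (if k \<le> r then lam k else 0)\<bar>" and smin_le: "smin \<le> g"
    and class_mem: "\<And>c s. c\<^sup>2 + s\<^sup>2 = 1 \<Longrightarrow> 0 \<le> c \<Longrightarrow> \<bar>s\<bar> \<le> smin / (8 * g) \<Longrightarrow>
        spectral_mat n r lam (rotate_pair e l k c s) \<in> \<A>"
begin

lemma ln: "l \<in> {1..n}" "l \<noteq> k" using l r k by auto

lemma eigvec_rotated:
  assumes "c\<^sup>2 + s\<^sup>2 = 1"
  shows "nth_eigenvector l (spectral_mat n r lam (rotate_pair e l k c s)) = rotate_pair e l k c s l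
    \<or> nth_eigenvector l (spectral_mat n r lam (rotate_pair e l k c s)) = - rotate_pair e l k c s l"
  by (rule nth_eigenvector_spectral_mat[OF _ r nz dec l simple])
     (rule orthonormal_mono[OF orthonormal_rotate_pair[OF e ln(1) k(1) ln(2) assms] r])

lemma frob_rotated_le:
  assumes "c\<^sup>2 + s\<^sup>2 = 1" "\<bar>s\<bar> \<le> smin / (8 * g)"
  shows "frob_norm (spectral_mat n r lam (rotate_pair e l k c s) - spectral_mat n r lam e) \<le> smin / 2"
  by (rule frob_norm_rotate_le[OF e r l k assms(1) g smin _ assms(2)]) (use smin smin_le in simp)

definition "angle = smin / (8 * g)"

lemma angle: "0 < angle" "angle \<le> 1 / 8"
  using smin smin_le by (auto simp: angle_def field_simps)

lemma cos_angle_nonneg: "0 \<le> sqrt (1 - angle\<^sup>2)"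
proof -
  have "angle\<^sup>2 \<le> 1\<^sup>2" using angle by (intro power_mono) auto
  then show ?thesis by simp
qed

lemma cos_angle: "\<sigma> \<in> {angle, - angle} \<Longrightarrow> (sqrt (1 - angle\<^sup>2))\<^sup>2 + \<sigma>\<^sup>2 = 1"
  using cos_angle_nonneg by auto

lemma base_mem: "spectral_mat n r lam e \<in> \<A>"
  using class_mem[of 1 0] smin smin_le rotate_pair_id[of e l n k] e ln k by (auto simp: orthonormal_def)

lemma eigvec_base: "nth_eigenvector l (spectral_mat n r lam e) = e l \<or> nth_eigenvector l (spectral_mat n r lam e) = - e l"
  by (rule nth_eigenvector_spectral_mat[OF orthonormal_mono[OF e r] r nz dec l simple])

lemma carrier_e: "e l \<in> carrier_vec n" "e l \<bullet> e l = 1" using e ln by (auto simp: orthonormal_def)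

lemma vec_minimax_rotation: "ennreal (smin / (32 * g)) \<le> vec_minimax n sd l \<A>"
proof -
  let ?c = "sqrt (1 - angle\<^sup>2)" and ?A = "spectral_mat n r lam (rotate_pair e l k (sqrt (1 - angle\<^sup>2)) angle)"
  let ?B = "spectral_mat n r lam e"
  have cs: "?c\<^sup>2 + angle\<^sup>2 = 1" "0 \<le> ?c" using cos_angle[of angle] cos_angle_nonneg by auto
  note x = rotate_pair_inner[OF e ln(1) k(1) ln(2) cs(1)]
  have "\<bar>angle\<bar> \<le> min_pm_vec (rotate_pair e l k ?c angle l) (e l)"
    by (rule min_pm_vec_ge_sin[OF x(1) carrier_e(1) x(2) carrier_e(2) x(3) cs(2,1)])
  also have "\<dots> = min_pm_vec (nth_eigenvector l ?A) (nth_eigenvector l ?B)"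
    using eigvec_rotated[OF cs(1)] eigvec_base x(1) carrier_e(1)
    by (auto simp: min_pm_vec_uminus_left[of _ n] min_pm_vec_uminus_right[of _ n])
  finally have "angle / 4 \<le> min_pm_vec (nth_eigenvector l ?A) (nth_eigenvector l ?B) / 4"
    using angle(1) by (simp only: abs_of_pos divide_right_mono zero_le_numeral)
  moreover have "angle / 4 = smin / (32 * g)" by (simp add: angle_def)
  ultimately have "smin / (32 * g) \<le> min_pm_vec (nth_eigenvector l ?A) (nth_eigenvector l ?B) / 4" by (simp only:)
  moreover have "ennreal (min_pm_vec (nth_eigenvector l ?A) (nth_eigenvector l ?B) / 4) \<le> vec_minimax n sd l \<A>"
  proof (rule vec_minimax_two_points[OF smin sd])
    show "?A \<in> \<A>" using cs angle by (intro class_mem) (auto simp: angle_def)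
    show "nth_eigenvector l ?A \<in> carrier_vec n" "nth_eigenvector l ?B \<in> carrier_vec n"
      using eigvec_rotated[OF cs(1)] eigvec_base x(1) carrier_e(1) by auto
    show "frob_norm (?A - ?B) \<le> smin / 2" using cs angle by (intro frob_rotated_le) (auto simp: angle_def)
  qed (auto intro: base_mem)
  ultimately show ?thesis by (meson ennreal_leI order_trans)
qed

lemma lin_minimax_rotation:
  assumes a: "a \<in> carrier_vec n"
  shows "ennreal ((\<bar>a \<bullet> e l\<bar> * (smin / (8 * g))\<^sup>2 + \<bar>a \<bullet> e k\<bar> * (smin / (8 * g))) / 8) \<le> lin_minimax n sd l a \<A>"
proof -
  let ?c = "sqrt (1 - angle\<^sup>2)"
  have cs0: "?c\<^sup>2 + angle\<^sup>2 = 1" "0 \<le> ?c" using cos_angle[of angle] cos_angle_nonneg by auto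
  obtain \<sigma> where \<sigma>: "\<sigma> \<in> {angle, - angle}"
    and gain: "(\<bar>a \<bullet> e l\<bar> * angle\<^sup>2 + \<bar>a \<bullet> e k\<bar> * angle) / 2 \<le> min_pm (?c * (a \<bullet> e l) + \<sigma> * (a \<bullet> e k)) (a \<bullet> e l)"
    using three_angles[OF cs0, of "a \<bullet> e l" "a \<bullet> e k"] angle by (meson less_imp_le)
  let ?A = "spectral_mat n r lam (rotate_pair e l k ?c \<sigma>)" and ?B = "spectral_mat n r lam e"
  have cs: "?c\<^sup>2 + \<sigma>\<^sup>2 = 1" using \<sigma> by (rule cos_angle)
  have s: "\<bar>\<sigma>\<bar> \<le> smin / (8 * g)" using \<sigma> angle by (auto simp: angle_def)
  note x = rotate_pair_inner[OF e ln(1) k(1) ln(2) cs]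
  have "\<bar>a \<bullet> nth_eigenvector l ?A\<bar> = \<bar>a \<bullet> rotate_pair e l k ?c \<sigma> l\<bar>"
    using eigvec_rotated[OF cs] x(1) a by auto
  moreover have "\<bar>a \<bullet> nth_eigenvector l ?B\<bar> = \<bar>a \<bullet> e l\<bar>" using eigvec_base carrier_e(1) a by auto
  ultimately have "min_pm (?c * (a \<bullet> e l) + \<sigma> * (a \<bullet> e k)) (a \<bullet> e l)
      = min_pm (a \<bullet> nth_eigenvector l ?A) (a \<bullet> nth_eigenvector l ?B)"
    unfolding min_pm_eq x(4)[OF a, symmetric] by simp
  with gain have "(\<bar>a \<bullet> e l\<bar> * angle\<^sup>2 + \<bar>a \<bullet> e k\<bar> * angle) / 8
      \<le> min_pm (a \<bullet> nth_eigenvector l ?A) (a \<bullet> nth_eigenvector l ?B) / 4"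
    by simp
  moreover have "ennreal (min_pm (a \<bullet> nth_eigenvector l ?A) (a \<bullet> nth_eigenvector l ?B) / 4) \<le> lin_minimax n sd l a \<A>"
  proof (rule lin_minimax_two_points[OF smin sd])
    show "?A \<in> \<A>" using cs cs0 s by (intro class_mem)
    show "frob_norm (?A - ?B) \<le> smin / 2" using cs s by (rule frob_rotated_le)
  qed (auto intro: base_mem)
  ultimately show ?thesis unfolding angle_def[symmetric] by (meson ennreal_leI order_trans)
qed

end

section \<open>Bounds from sign patterns\<close>

text \<open>
  Let the coordinates beyond \<open>r\<close> of a vector be \<open>q\<close> or \<open>- q\<close> and let its coordinate \<open>l\<close> be at least as large as
  all of these together. After a global sign has been fixed by the coordinate \<open>l\<close> of the estimate
  \<open>y\<close>, each wrong sign costs at least \<open>q\<^sup>2\<close>, whichever sign \<open>\<sigma>\<close> the loss picks.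
\<close>

lemma sign_pattern_error:
  fixes y f :: "nat \<Rightarrow> real"
  assumes l: "1 \<le> l" "l \<le> r" and n: "n = r + d" and fl: "f l = c" "0 \<le> c" and dq: "real d * q\<^sup>2 \<le> c\<^sup>2" and q: "0 \<le> q"
    and f: "\<And>i. i < d \<Longrightarrow> f (r + 1 + i) = (if i \<in> S then q else - q)"
    and sg: "\<sigma> = 1 \<or> \<sigma> = -1"
  shows "q\<^sup>2 * real (card {i\<in>{..<d}. ((0 \<le> y (r + 1 + i)) = (0 \<le> y l)) \<noteq> (i \<in> S)}) \<le> (\<Sum>k = 1..n. (y k - \<sigma> * f k)\<^sup>2)"
    (is "q\<^sup>2 * real (card ?W) \<le> ?R")
proof (cases "\<sigma> = 1 \<longleftrightarrow> 0 \<le> y l")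
  case True
  have "q\<^sup>2 * real (card ?W) = (\<Sum>i\<in>?W. q\<^sup>2)" by simp
  also have "\<dots> \<le> (\<Sum>i\<in>?W. (y (r + 1 + i) - \<sigma> * f (r + 1 + i))\<^sup>2)"
  proof (rule sum_mono)
    fix i assume i: "i \<in> ?W"
    have "q \<le> \<bar>y (r + 1 + i) - \<sigma> * f (r + 1 + i)\<bar>"
      using i f[of i] True sg q by (auto simp: abs_if split: if_splits)
    then show "q\<^sup>2 \<le> (y (r + 1 + i) - \<sigma> * f (r + 1 + i))\<^sup>2" using q by (metis abs_le_square_iff abs_of_nonneg)
  qed
  also have "\<dots> = (\<Sum>k\<in>(\<lambda>i. r + 1 + i) ` ?W. (y k - \<sigma> * f k)\<^sup>2)"
    by (subst sum.reindex) (auto simp: inj_on_def)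
  also have "\<dots> \<le> ?R" using n by (intro sum_mono2) auto
  finally show ?thesis .
next
  case False
  \<comment> \<open>The wrong global sign costs at least \<open>c\<close> in coordinate \<open>l\<close>, as much as all sign errors together.\<close>
  have "card ?W \<le> card {..<d}" by (intro card_mono) auto
  then have "real (card ?W) \<le> real d" by simp
  then have "real (card ?W) * q\<^sup>2 \<le> real d * q\<^sup>2" by (rule mult_right_mono) simp
  then have "q\<^sup>2 * real (card ?W) \<le> real d * q\<^sup>2" by (simp only: mult.commute[of "q\<^sup>2"])
  also have "\<dots> \<le> c\<^sup>2" by (rule dq)
  also have "\<dots> \<le> (y l - \<sigma> * f l)\<^sup>2"
  proof -
    have "c \<le> \<bar>y l - \<sigma> * f l\<bar>" using False sg fl by (auto simp: abs_if split: if_splits)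
    then show ?thesis using fl(2) by (metis abs_le_square_iff abs_of_nonneg)
  qed
  also have "\<dots> \<le> ?R" using l n by (intro member_le_sum) auto
  finally show ?thesis .
qed

text \<open>
  At most \<open>d\<close> signs are wrong, so the root of their number is at least the number divided by
  \<open>sqrt d\<close>. This makes the Euclidean loss additive over the coordinates.
\<close>

lemma hypercube_loss:
  assumes e: "orthonormal n n e" and y: "y \<in> carrier_vec n"
    and l: "1 \<le> l" "l \<le> r" and n: "n = r + d" and fl: "f l = c" "0 \<le> c" and dq: "real d * q\<^sup>2 \<le> c\<^sup>2" and q: "0 \<le> q"
    and f: "\<And>i. i < d \<Longrightarrow> f (r + 1 + i) = (if i \<in> S then q else - q)" and d: "0 < d"
  shows "q / sqrt (real d) * real (card {i\<in>{..<d}. ((0 \<le> y \<bullet> e (r + 1 + i)) = (0 \<le> y \<bullet> e l)) \<noteq> (i \<in> S)})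
     \<le> min_pm_vec y (basis_comb n e f)" (is "_ * real (card ?W) \<le> _")
proof -
  have "card ?W \<le> card {..<d}" by (intro card_mono) auto
  then have W: "real (card ?W) \<le> real d" by simp
  have "(q / sqrt (real d) * real (card ?W))\<^sup>2 = q\<^sup>2 * (real (card ?W) * real (card ?W) / real d)"
    using d unfolding power_mult_distrib power_divide power2_eq_square[of "real (card ?W)"] by simp
  also have "\<dots> \<le> q\<^sup>2 * real (card ?W)"
  proof (rule mult_left_mono)
    show "real (card ?W) * real (card ?W) / real d \<le> real (card ?W)"
      using mult_left_mono[OF W, of "real (card ?W)"] d by (subst pos_divide_le_eq) auto
  qed simp
  finally have sq: "(q / sqrt (real d) * real (card ?W))\<^sup>2 \<le> q\<^sup>2 * real (card ?W)" .
  have *: "q / sqrt (real d) * real (card ?W) \<le> norm2 (y - basis_comb n e (\<lambda>k. \<sigma> * f k))"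
    if "\<sigma> = 1 \<or> \<sigma> = -1" for \<sigma>
  proof (rule power2_le_imp_le)
    have "q\<^sup>2 * real (card ?W) \<le> (\<Sum>k = 1..n. (y \<bullet> e k - \<sigma> * f k)\<^sup>2)"
      by (rule sign_pattern_error[OF l n fl dq q f that])
    also have "\<dots> \<le> (norm2 (y - basis_comb n e (\<lambda>k. \<sigma> * f k)))\<^sup>2"
      by (rule coordinate_error_le[OF e y])
    finally show "(q / sqrt (real d) * real (card ?W))\<^sup>2 \<le> (norm2 (y - basis_comb n e (\<lambda>k. \<sigma> * f k)))\<^sup>2"
      using sq by simp
  qed simp
  have "- basis_comb n e f = basis_comb n e (\<lambda>k. (-1) * f k)"
    by (intro eq_vecI) (auto simp: basis_comb_def sum_negf)
  then show ?thesis
    unfolding min_pm_vec_eq[OF y basis_comb_carrier] using *[of 1] *[of "-1"] by simp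
qed

section \<open>The three parameter classes\<close>

lemma settingD:
  assumes "setting n r l lam u sd smin"
  shows "1 \<le> l" "l \<le> r" "2 * r \<le> n" "orthonormal n r u" "\<forall>j\<in>{1..r}. lam j \<noteq> 0"
    "\<forall>i\<in>{1..r}. \<forall>j\<in>{1..r}. i \<le> j \<longrightarrow> lam j \<le> lam i"
    "0 \<le> smin" "\<forall>i<n. \<forall>j<n. (sd i j)\<^sup>2 \<ge> smin\<^sup>2" "4 * smin * sqrt (real n) \<le> \<bar>lam l\<bar>"
    "\<forall>k\<in>{1..r} - {l}. smin \<le> \<bar>lam l - lam k\<bar>"
proof -
  have "ennreal smin \<le> ennreal \<bar>lam l - lam k\<bar>" if "k \<in> {1..r} - {l}" for k
    using assms INF_lower[OF that, of "\<lambda>k. ennreal \<bar>lam l - lam k\<bar>"]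
    unfolding setting_def eigengap_def by (meson order_trans)
  then show "\<forall>k\<in>{1..r} - {l}. smin \<le> \<bar>lam l - lam k\<bar>" by (simp add: ennreal_le_iff)
qed (use assms in \<open>auto simp: setting_def eigenpairs_def orthonormal_def\<close>)

text \<open>
  For rotations towards another eigenvector of the true matrix the perturbed matrix stays close to the
  true one.
\<close>

lemma rotation_M0:
  assumes set: "setting n r l lam u sd smin" and smin: "0 < smin" and k: "k \<in> {1..r} - {l}"
    and e: "orthonormal n n e" "\<forall>j\<in>{1..r}. e j = u j"
  shows "rotation_hypotheses n r l k lam e sd smin \<bar>lam l - lam k\<bar> (M0 n r lam u smin)"
proof -
  note S = settingD[OF set]
  let ?g = "\<bar>lam l - lam k\<bar>"
  have gs: "smin \<le> ?g" using S(10) k by blast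
  have ln: "l \<in> {1..n}" "k \<in> {1..n}" "l \<noteq> k" "r \<le> n" using S(1-3) k by auto
  show ?thesis
  proof
    fix c s :: real assume cs: "c\<^sup>2 + s\<^sup>2 = 1" "0 \<le> c" and s: "\<bar>s\<bar> \<le> smin / (8 * ?g)"
    let ?A = "spectral_mat n r lam (rotate_pair e l k c s)"
    have "?A \<in> isospectral n r lam"
      by (rule spectral_mat_isospectral[OF orthonormal_mono[OF orthonormal_rotate_pair[OF e(1) ln(1-3) cs(1)] ln(4)] ln(4) S(5,6)])
    moreover have "frob_norm (?A - spectral_mat n r lam u) \<le> smin / 2"
    proof -
      have "spectral_mat n r lam u = spectral_mat n r lam e"
        using e(2) by (intro spectral_mat_cong) auto
      moreover have "?g = \<bar>lam l - (if k \<le> r then lam k else 0)\<bar>" using k by simp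
      moreover have "0 < ?g" using gs smin by simp
      ultimately show ?thesis
        using frob_norm_rotate_le[OF e(1) ln(4) _ ln(2) ln(3)[symmetric] cs(1) _ smin _ s, where lam = lam] S(1,2) by simp
    qed
    ultimately show "?A \<in> M0 n r lam u smin" unfolding M0_def by simp
  next
    show "\<forall>j\<in>{1..r} - {l}. lam j \<noteq> lam l" using S(10) smin by (metis abs_zero diff_self not_le)
    show "?g = \<bar>lam l - (if k \<le> r then lam k else 0)\<bar>" using k by simp
  qed (use S k ln smin gs e in auto)
qed

text \<open>
  Membership in this class only constrains the \<open>l\<close>-th eigenvector. Hence the other eigenvectors may be
  placed orthogonally to the direction of the tilt, which then lies in the kernel. This removes the
  dependence on the remaining eigenvalues.
\<close>

lemma rotation_M1:
  assumes set: "setting n r l lam u sd smin" and smin: "0 < smin"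
    and e: "orthonormal n n e" "e l = u l"
  shows "rotation_hypotheses n r l (r + 1) lam e sd smin \<bar>lam l\<bar> (M1 n r lam u l smin)"
proof -
  note S = settingD[OF set]
  have ln: "l \<in> {1..n}" "r + 1 \<in> {1..n}" "l \<noteq> r + 1" "r \<le> n" "l \<in> {1..r}" using S(1-3) by auto
  have simple: "\<forall>j\<in>{1..r} - {l}. lam j \<noteq> lam l" using S(10) smin by (metis abs_zero diff_self not_le)
  have "smin * 1 \<le> (4 * smin) * sqrt (real n)" using smin ln(1) by (intro mult_mono) auto
  then have gs: "smin \<le> \<bar>lam l\<bar>" using S(9) by simp
  have el: "e l \<in> carrier_vec n" "e l \<bullet> e l = 1" using e(1) ln(1) by (auto simp: orthonormal_def)
  show ?thesis
  proof
    fix c s :: real assume cs: "c\<^sup>2 + s\<^sup>2 = 1" "0 \<le> c" and s: "\<bar>s\<bar> \<le> smin / (8 * \<bar>lam l\<bar>)"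
    let ?v = "rotate_pair e l (r + 1) c s"
    let ?A = "spectral_mat n r lam ?v"
    have o: "orthonormal n r ?v"
      by (rule orthonormal_mono[OF orthonormal_rotate_pair[OF e(1) ln(1-3) cs(1)] ln(4)])
    have "?A \<in> isospectral n r lam" by (rule spectral_mat_isospectral[OF o ln(4) S(5,6)])
    moreover have "min_pm_vec (nth_eigenvector l ?A) (u l) \<le> smin / (4 * \<bar>lam l\<bar>)"
    proof -
      note x = rotate_pair_inner[OF e(1) ln(1-3) cs(1)]
      have "min_pm_vec (nth_eigenvector l ?A) (u l) = min_pm_vec (?v l) (e l)"
        using nth_eigenvector_spectral_mat[OF o ln(4) S(5,6) ln(5) simple] x(1) el(1) e(2)
        by (auto simp: min_pm_vec_uminus_left[of _ n])
      also have "\<dots> \<le> sqrt 2 * \<bar>s\<bar>"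
        by (rule min_pm_vec_le_sin[OF x(1) el(1) x(2) el(2) x(3) cs(2,1)])
      also have "\<dots> \<le> 2 * (smin / (8 * \<bar>lam l\<bar>))"
        using s by (intro mult_mono) (auto intro: real_le_lsqrt)
      finally show ?thesis by simp
    qed
    ultimately show "?A \<in> M1 n r lam u l smin" unfolding M1_def by simp
  next
    show "\<bar>lam l\<bar> = \<bar>lam l - (if r + 1 \<le> r then lam (r + 1) else 0)\<bar>" by simp
  qed (use S ln smin gs e simple in auto)
qed

text \<open>
  The tilt goes in the direction of the part of \<open>a\<close> that is orthogonal to \<open>u l\<close>, where the linear
  form changes fastest.
\<close>

lemma lin_minimax_M1:
  assumes set: "setting n r l lam u sd smin" and a: "a \<in> carrier_vec n"
  shows "ennreal (1 / 64 * (smin * norm2 (a - (a \<bullet> u l) \<cdot>\<^sub>v u l) / \<bar>lam l\<bar>)) \<le> lin_minimax n sd l a (M1 n r lam u l smin)"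
proof -
  note S = settingD[OF set]
  let ?b = "a - (a \<bullet> u l) \<cdot>\<^sub>v u l"
  have ul: "u l \<in> carrier_vec n" "u l \<bullet> u l = 1" using S(1,2,4) by (auto simp: orthonormal_def)
  have b: "?b \<in> carrier_vec n" using ul a by simp
  have ub: "u l \<bullet> ?b = 0"
    using ul a comm_scalar_prod[OF a ul(1)] by (simp add: scalar_prod_minus_distrib[of _ n])
  have ab: "a \<bullet> ?b = (norm2 ?b)\<^sup>2"
  proof -
    have "?b \<bullet> ?b = a \<bullet> ?b - (a \<bullet> u l) * (u l \<bullet> ?b)"
      using ul a b by (subst minus_scalar_prod_distrib[of _ n]) auto
    then show ?thesis using ub by (simp add: norm2_power2)
  qed
  show ?thesis
  proof (cases "smin = 0 \<or> norm2 ?b = 0")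
    case True then show ?thesis by auto
  next
    case False
    then have smin: "0 < smin" and nb: "0 < norm2 ?b" using S(7) norm2_nonneg[of ?b] by linarith+
    define w where "w = (1 / norm2 ?b) \<cdot>\<^sub>v ?b"
    have w: "w \<in> carrier_vec n" "w \<bullet> w = 1" "u l \<bullet> w = 0" "a \<bullet> w = norm2 ?b"
    proof -
      show "w \<in> carrier_vec n" "u l \<bullet> w = 0" unfolding w_def using b ub ul by simp_all
      have "w \<bullet> w = 1 / norm2 ?b * (1 / norm2 ?b * (?b \<bullet> ?b))" unfolding w_def using b by simp
      also have "?b \<bullet> ?b = (norm2 ?b)\<^sup>2" by (rule norm2_power2[symmetric])
      finally show "w \<bullet> w = 1" using nb by (simp add: power2_eq_square)
      have "a \<bullet> w = 1 / norm2 ?b * (a \<bullet> ?b)" unfolding w_def using a b by simp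
      then show "a \<bullet> w = norm2 ?b" unfolding ab using nb by (simp add: power2_eq_square)
    qed
    obtain e where e: "orthonormal n n e" "e l = u l" "e (r + 1) = w"
      using orthonormal_basis_through_pair[OF ul w(1,2,3), of l "r + 1"] S(1-3) by auto
    interpret R: rotation_hypotheses n r l "r + 1" lam e sd smin "\<bar>lam l\<bar>" "M1 n r lam u l smin"
      by (rule rotation_M1[OF set smin e(1,2)])
    have "1 / 64 * (smin * norm2 ?b / \<bar>lam l\<bar>) = (\<bar>a \<bullet> e (r + 1)\<bar> * (smin / (8 * \<bar>lam l\<bar>))) / 8"
      using e(3) w(4) by simp
    also have "\<dots> \<le> (\<bar>a \<bullet> e l\<bar> * (smin / (8 * \<bar>lam l\<bar>))\<^sup>2 + \<bar>a \<bullet> e (r + 1)\<bar> * (smin / (8 * \<bar>lam l\<bar>))) / 8"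
      by (intro divide_right_mono add_increasing order_refl mult_nonneg_nonneg) auto
    finally show ?thesis using R.lin_minimax_rotation[OF a] by (meson ennreal_leI order_trans)
  qed
qed

lemma eigengap_attained:
  assumes "{1..r} - {l} \<noteq> {}"
  obtains k where "k \<in> {1..r} - {l}" "eigengap r lam l = ennreal \<bar>lam l - lam k\<bar>"
proof -
  let ?I = "(\<lambda>k. ennreal \<bar>lam l - lam k\<bar>) ` ({1..r} - {l})"
  have "Min ?I \<in> ?I" using assms by (intro Min_in) auto
  moreover have "Min ?I = Inf ?I" using assms by (intro Min_Inf) auto
  ultimately have "Inf ?I \<in> ?I" by (simp only:)
  then obtain k where "k \<in> {1..r} - {l}" "Inf ?I = ennreal \<bar>lam l - lam k\<bar>" by (rule imageE) (rule that)
  then show ?thesis unfolding eigengap_def by (rule that[unfolded eigengap_def])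
qed

text \<open>
  The tilt towards the eigenvector with the closest eigenvalue yields the vector bound and the
  term with \<open>\<bar>a \<bullet> u l\<bar>\<close>; the tilt towards each \<open>u k\<close> yields the corresponding term of the maximum. For
  \<open>r = 1\<close> the infimum over the gaps and the supremum range over the empty set and both bounds vanish.
\<close>

lemma minimax_M0:
  assumes set: "setting n r l lam u sd smin" and a: "a \<in> carrier_vec n"
  shows "ennreal (1 / 32) * (ennreal smin / eigengap r lam l) \<le> vec_minimax n sd l (M0 n r lam u smin)"
    "ennreal (1 / 1024) *
             (ennreal \<bar>a \<bullet> u l\<bar> * ((ennreal smin)\<^sup>2 / (eigengap r lam l)\<^sup>2) +
              ennreal smin *
                (SUP k\<in>{1..r} - {l}. ennreal \<bar>a \<bullet> u k\<bar> / ennreal \<bar>lam l - lam k\<bar>))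
      \<le> lin_minimax n sd l a (M0 n r lam u smin)"
proof -
  note S = settingD[OF set]
  have "ennreal (1 / 32) * (ennreal smin / eigengap r lam l) \<le> vec_minimax n sd l (M0 n r lam u smin) \<and>
    ennreal (1 / 1024) *
             (ennreal \<bar>a \<bullet> u l\<bar> * ((ennreal smin)\<^sup>2 / (eigengap r lam l)\<^sup>2) +
              ennreal smin *
                (SUP k\<in>{1..r} - {l}. ennreal \<bar>a \<bullet> u k\<bar> / ennreal \<bar>lam l - lam k\<bar>))
      \<le> lin_minimax n sd l a (M0 n r lam u smin)"
  proof (cases "smin = 0 \<or> {1..r} - {l} = {}")
    case True
    then show ?thesis
    proof
      assume "{1..r} - {l} = {}"
      have "eigengap r lam l = \<top>" unfolding eigengap_def \<open>{1..r} - {l} = {}\<close> by simp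
      then show ?thesis unfolding \<open>{1..r} - {l} = {}\<close> by (simp add: power2_eq_square ennreal_top_mult bot_ennreal)
    qed simp
  next
    case False
    then have smin: "0 < smin" using S(7) by simp
    let ?lin = "lin_minimax n sd l a (M0 n r lam u smin)"
    obtain e where e: "orthonormal n n e" "\<forall>j\<in>{1..r}. e j = u j"
      using orthonormal_extension[OF S(4)] S(3) by auto
    have el: "e l = u l" using e(2) S(1,2) by simp
    have g0: "0 < \<bar>lam l - lam k\<bar>" if "k \<in> {1..r} - {l}" for k
      using less_le_trans[OF smin] S(10) that by blast
    obtain k0 where k0: "k0 \<in> {1..r} - {l}" "eigengap r lam l = ennreal \<bar>lam l - lam k0\<bar>"
      using False eigengap_attained by metis
    let ?g = "\<bar>lam l - lam k0\<bar>"
    interpret K: rotation_hypotheses n r l k0 lam e sd smin ?g "M0 n r lam u smin"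
      by (rule rotation_M0[OF set smin k0(1) e])
    have "ennreal (1 / 32) * (ennreal smin / eigengap r lam l) = ennreal (1 / 32 * (smin / ?g))"
      unfolding k0(2) using smin g0[OF k0(1)] by (simp add: divide_ennreal flip: ennreal_mult)
    also have "1 / 32 * (smin / ?g) = smin / (32 * ?g)" by simp
    finally have 1: "ennreal (1 / 32) * (ennreal smin / eigengap r lam l) \<le> vec_minimax n sd l (M0 n r lam u smin)"
      using K.vec_minimax_rotation by simp
    have 2: "ennreal \<bar>a \<bullet> u l\<bar> * ((ennreal smin)\<^sup>2 / (eigengap r lam l)\<^sup>2) \<le> ennreal 512 * ?lin"
    proof -
      let ?P = "\<bar>a \<bullet> u l\<bar> * (smin\<^sup>2 / ?g\<^sup>2)"
      have "ennreal \<bar>a \<bullet> u l\<bar> * ((ennreal smin)\<^sup>2 / (eigengap r lam l)\<^sup>2) = ennreal ?P"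
        unfolding k0(2) using smin g0[OF k0(1)] by (simp add: divide_ennreal ennreal_power flip: ennreal_mult)
      also have "?P = 512 * (?P / 512)" by simp
      also have "ennreal \<dots> = ennreal 512 * ennreal (?P / 512)" by (rule ennreal_mult') simp
      also have "\<dots> \<le> ennreal 512 * ?lin"
      proof (rule mult_left_mono)
        have "?P / 512 = (\<bar>a \<bullet> e l\<bar> * (smin / (8 * ?g))\<^sup>2) / 8" unfolding el by (simp add: power_divide power_mult_distrib)
        also have "\<dots> \<le> (\<bar>a \<bullet> e l\<bar> * (smin / (8 * ?g))\<^sup>2 + \<bar>a \<bullet> e k0\<bar> * (smin / (8 * ?g))) / 8"
          using smin by simp
        finally show "ennreal (?P / 512) \<le> ?lin"
          using K.lin_minimax_rotation[OF a] by (meson ennreal_leI order_trans)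
      qed simp
      finally show ?thesis .
    qed
    have 3: "ennreal smin * (SUP k\<in>{1..r} - {l}. ennreal \<bar>a \<bullet> u k\<bar> / ennreal \<bar>lam l - lam k\<bar>) \<le> ennreal 64 * ?lin"
      unfolding SUP_mult_left_ennreal
    proof (rule SUP_least)
      fix k assume k: "k \<in> {1..r} - {l}"
      let ?h = "\<bar>lam l - lam k\<bar>"
      let ?Q = "smin * (\<bar>a \<bullet> u k\<bar> / ?h)"
      interpret R: rotation_hypotheses n r l k lam e sd smin ?h "M0 n r lam u smin"
        by (rule rotation_M0[OF set smin k e])
      have ek: "e k = u k" using e(2) k by simp
      have "ennreal smin * (ennreal \<bar>a \<bullet> u k\<bar> / ennreal ?h) = ennreal ?Q"
        using smin g0[OF k] by (simp add: divide_ennreal flip: ennreal_mult)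
      also have "?Q = 64 * (?Q / 64)" by simp
      also have "ennreal \<dots> = ennreal 64 * ennreal (?Q / 64)" by (rule ennreal_mult') simp
      also have "\<dots> \<le> ennreal 64 * ?lin"
      proof (rule mult_left_mono)
        have "?Q / 64 = (\<bar>a \<bullet> e k\<bar> * (smin / (8 * ?h))) / 8" unfolding ek by (simp add: mult.commute)
        also have "\<dots> \<le> (\<bar>a \<bullet> e l\<bar> * (smin / (8 * ?h))\<^sup>2 + \<bar>a \<bullet> e k\<bar> * (smin / (8 * ?h))) / 8"
          by (intro divide_right_mono add_increasing order_refl mult_nonneg_nonneg) auto
        finally show "ennreal (?Q / 64) \<le> ?lin"
          using R.lin_minimax_rotation[OF a] by (meson ennreal_leI order_trans)
      qed simp
      finally show "ennreal smin * (ennreal \<bar>a \<bullet> u k\<bar> / ennreal ?h) \<le> ennreal 64 * ?lin" .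
    qed
    have "ennreal (1 / 1024) *
             (ennreal \<bar>a \<bullet> u l\<bar> * ((ennreal smin)\<^sup>2 / (eigengap r lam l)\<^sup>2) +
              ennreal smin *
                (SUP k\<in>{1..r} - {l}. ennreal \<bar>a \<bullet> u k\<bar> / ennreal \<bar>lam l - lam k\<bar>))
       \<le> ennreal (1 / 1024) * (ennreal 512 * ?lin + ennreal 64 * ?lin)"
      by (intro mult_left_mono add_mono 2 3) auto
    also have "\<dots> = (ennreal (1 / 1024) * (ennreal 512 + ennreal 64)) * ?lin"
      by (simp only: distrib_right mult.assoc)
    also have "ennreal (1 / 1024) * (ennreal 512 + ennreal 64) = ennreal (9 / 16)"
      by (subst ennreal_plus[symmetric], simp, simp, subst ennreal_mult[symmetric]) auto
    also have "ennreal (9 / 16) * ?lin \<le> 1 * ?lin" by (intro mult_right_mono) (auto intro: ennreal_leI)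
    finally show ?thesis using 1 by simp
  qed
  then show "ennreal (1 / 32) * (ennreal smin / eigengap r lam l) \<le> vec_minimax n sd l (M0 n r lam u smin)"
    "ennreal (1 / 1024) *
             (ennreal \<bar>a \<bullet> u l\<bar> * ((ennreal smin)\<^sup>2 / (eigengap r lam l)\<^sup>2) +
              ennreal smin *
                (SUP k\<in>{1..r} - {l}. ennreal \<bar>a \<bullet> u k\<bar> / ennreal \<bar>lam l - lam k\<bar>))
      \<le> lin_minimax n sd l a (M0 n r lam u smin)" by blast+
qed

text \<open>
  The \<open>l\<close>-th eigenvector is perturbed in all \<open>d = n - r\<close> kernel directions at once, by independent signs.
  No single sign can be recovered, and each wrong one contributes \<open>q\<^sup>2\<close> to the squared loss; as
  \<open>d \<ge> n / 2\<close>, this gives the factor \<open>sqrt n\<close>.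
\<close>

lemma vec_minimax_M2:
  assumes set: "setting n r l lam u sd smin" and c4: "1 \<le> c4"
  shows "ennreal (1 / 64 * (smin * sqrt (real n) / \<bar>lam l\<bar>)) \<le> vec_minimax n sd l (M2 c4 n r lam u l smin)"
proof (cases "smin = 0")
  case True then show ?thesis by simp
next
  case False
  note S = settingD[OF set]
  have smin: "0 < smin" using False S(7) by simp
  have r: "r \<le> n" and l: "l \<in> {1..r}" and ln: "l \<in> {1..n}" using S(1-3) by auto
  have simple: "\<forall>j\<in>{1..r} - {l}. lam j \<noteq> lam l" using S(10) smin by (metis abs_zero diff_self not_le)
  have lam0: "0 < \<bar>lam l\<bar>" using S(5) l by simp
  obtain e where e: "orthonormal n n e" "\<forall>j\<in>{1..r}. e j = u j"
    using orthonormal_extension[OF S(4) r] by blast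
  define d where "d = n - r"
  have d: "n = r + d" "0 < d" "real n \<le> 2 * real d" using S(1-3) by (auto simp: d_def)
  \<comment> \<open>Flipping one sign moves \<open>u l\<close> by \<open>2 * q\<close> and hence the matrix by at most
      \<open>4 * q * \<bar>lam l\<bar> = smin / 2\<close>.\<close>
  define q where "q = smin / (8 * \<bar>lam l\<bar>)"
  have q: "0 < q" using smin lam0 by (simp add: q_def)
  have dq: "real d * q\<^sup>2 \<le> 1 / 2"
  proof -
    have "sqrt (real d) * q \<le> sqrt (real n) * q" using d q by (intro mult_right_mono) auto
    also have "\<dots> \<le> 1 / 32" using S(9) lam0 by (simp add: q_def field_simps)
    finally have "(sqrt (real d) * q)\<^sup>2 \<le> (1 / 32)\<^sup>2" using q by (intro power_mono) auto
    then show ?thesis by (simp add: power_mult_distrib power_divide)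
  qed
  define c where "c = sqrt (1 - real d * q\<^sup>2)"
  have c: "0 \<le> c" "c\<^sup>2 = 1 - real d * q\<^sup>2" using dq by (auto simp: c_def)
  define f where "f S k = (if k = l then c else if r < k then (if k - r - 1 \<in> S then q else - q) else 0)" for S k
  have fS: "f S l = c" "f S (r + 1 + i) = (if i \<in> S then q else - q)" "k \<in> {1..r} - {l} \<Longrightarrow> f S k = 0" for S i k
    using l by (auto simp: f_def)
  have inner: "basis_comb n e (f S) \<bullet> basis_comb n e (f T) = c\<^sup>2 + (\<Sum>i<d. f S (r + 1 + i) * f T (r + 1 + i))" for S T
  proof -
    have "(\<Sum>k = 1..n. f S k * f T k) = (\<Sum>k\<in>{1..r} \<union> {r + 1..n}. f S k * f T k)"
      using r by (intro sum.cong) auto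
    also have "\<dots> = (\<Sum>k = 1..r. f S k * f T k) + (\<Sum>k = r + 1..n. f S k * f T k)"
      by (rule sum.union_disjoint) auto
    also have "(\<Sum>k = 1..r. f S k * f T k) = (\<Sum>k = 1..r. if k = l then c\<^sup>2 else 0)"
      using fS by (intro sum.cong refl) (auto simp: power2_eq_square)
    also have "\<dots> = c\<^sup>2" using l by simp
    also have "(\<Sum>k = r + 1..n. f S k * f T k) = (\<Sum>i<d. f S (r + 1 + i) * f T (r + 1 + i))"
      by (rule sum.reindex_bij_witness[of _ "\<lambda>i. r + 1 + i" "\<lambda>k. k - r - 1"]) (use d in auto)
    finally show ?thesis unfolding basis_comb_inner[OF e(1)] .
  qed
  have unit: "basis_comb n e (f S) \<bullet> basis_comb n e (f S) = 1" for S
  proof -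
    have "(\<Sum>i<d. f S (r + 1 + i) * f S (r + 1 + i)) = (\<Sum>i<d. q\<^sup>2)"
      unfolding fS(2) by (intro sum.cong) (auto simp: power2_eq_square)
    then show ?thesis unfolding inner using c by simp
  qed
  have flip: "basis_comb n e (f S) \<bullet> basis_comb n e (f (insert i S)) = 1 - 2 * q\<^sup>2" if "i < d" "i \<notin> S" for S i
  proof -
    have "(\<Sum>j<d. f S (r + 1 + j) * f (insert i S) (r + 1 + j)) = (\<Sum>j<d. q\<^sup>2 - (if j = i then 2 * q\<^sup>2 else 0))"
      unfolding fS(2) using that by (intro sum.cong) (auto simp: power2_eq_square)
    also have "\<dots> = real d * q\<^sup>2 - 2 * q\<^sup>2" using that by (simp add: sum_subtractf)
    finally show ?thesis unfolding inner using c by simp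
  qed
  define v where "v S = e(l := basis_comb n e (f S))" for S
  define A where "A S = spectral_mat n r lam (v S)" for S
  have v: "orthonormal n r (v S)" for S
  proof -
    have "basis_comb n e (f S) \<bullet> e k = 0" "e k \<bullet> basis_comb n e (f S) = 0" if "k \<in> {1..r} - {l}" for k
    proof -
      show 0: "basis_comb n e (f S) \<bullet> e k = 0"
        using basis_comb_coord[OF e(1), of k "f S"] fS(3) that r by auto
      show "e k \<bullet> basis_comb n e (f S) = 0"
        using 0 comm_scalar_prod[of "e k" n "basis_comb n e (f S)"] e(1) that r by (auto simp: orthonormal_def)
    qed
    then show ?thesis
      using e(1) unit[of S] r unfolding orthonormal_def v_def by auto
  qed
  have ev: "nth_eigenvector l (A S) = basis_comb n e (f S) \<or> nth_eigenvector l (A S) = - basis_comb n e (f S)" for S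
    using nth_eigenvector_spectral_mat[OF v[of S] r S(5,6) l simple] unfolding A_def v_def by simp
  have mem: "A S \<in> M2 c4 n r lam u l smin" for S
  proof -
    have el: "e l \<in> carrier_vec n" "e l \<bullet> e l = 1" using e(1) ln by (auto simp: orthonormal_def)
    have "min_pm_vec (nth_eigenvector l (A S)) (u l) = min_pm_vec (basis_comb n e (f S)) (e l)"
      using ev[of S] el e(2) l by (auto simp: min_pm_vec_uminus_left[of _ n])
    also have "\<dots> \<le> sqrt 2 * \<bar>sqrt (real d) * q\<bar>"
      by (rule min_pm_vec_le_sin[OF _ el(1) unit el(2)])
         (use basis_comb_coord[OF e(1) ln, of "f S"] fS(1) c in \<open>auto simp: power_mult_distrib\<close>)
    also have "\<dots> \<le> 2 * (sqrt (real n) * q)"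
      using q d by (intro mult_mono) (auto intro: real_le_lsqrt simp: abs_mult)
    also have "\<dots> \<le> 1 * (smin * sqrt (real n) / \<bar>lam l\<bar>)"
      using smin lam0 by (simp add: q_def field_simps)
    also have "\<dots> \<le> c4 * (smin * sqrt (real n) / \<bar>lam l\<bar>)"
      using c4 smin by (intro mult_right_mono) auto
    finally show ?thesis
      using spectral_mat_isospectral[OF v[of S] r S(5,6)] unfolding M2_def A_def by simp
  qed
  have "ennreal (q / sqrt (real d) * real d / 4) \<le> (SUP A\<in>M2 c4 n r lam u l smin. vec_risk n sd l est A)"
    if est: "est \<in> vec_estimators n" for est
  proof -
    \<comment> \<open>The estimate is defined up to sign; its component along \<open>e l\<close> fixes the sign before the signs
        of the other coordinates are read off.\<close>
    define \<eta> where "\<eta> X i = ((0 \<le> est X \<bullet> e (r + 1 + i)) = (0 \<le> est X \<bullet> e l))" for X i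
    have coord: "(\<lambda>h. est (mat n n h) \<bullet> e k) \<in> borel_measurable (entry_space n)" if "k \<in> {1..n}" for k
    proof -
      have "dim_vec (e k) = n" using e(1) that by (auto simp: orthonormal_def)
      then show ?thesis unfolding scalar_prod_def
        using vec_estimator_coord_measurable[OF est]
        by (intro borel_measurable_sum borel_measurable_times) auto
    qed
    have "ennreal (q / sqrt (real d) * real d / 4)
        \<le> (SUP S\<in>Pow {..<d}. \<integral>\<^sup>+h. ennreal (min_pm_vec (est (A S + mat n n h)) (nth_eigenvector l (A S))) \<partial>noise_law n sd)"
    proof (rule hypercube_risk_bound[where \<eta> = \<eta> and L = "\<lambda>S X. ennreal (min_pm_vec (est X) (nth_eigenvector l (A S)))",
          OF smin S(8)])
      show "A S \<in> carrier_mat n n" for S by (simp add: A_def)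
      show "frob_norm (A S - A (insert i S)) \<le> smin / 2" if "i < d" "i \<notin> S" for S i
      proof -
        have "frob_norm (A S - A (insert i S)) = \<bar>lam l\<bar> * sqrt (2 - 2 * (1 - 2 * q\<^sup>2)\<^sup>2)"
          unfolding A_def v_def spectral_mat_replace_diff[OF l] flip[OF that, symmetric]
          by (intro frob_norm_outer_diff unit) auto
        also have "\<dots> \<le> \<bar>lam l\<bar> * (4 * q)"
        proof (intro mult_left_mono real_le_lsqrt)
          have "2 - 2 * (1 - 2 * q\<^sup>2)\<^sup>2 = 8 * q\<^sup>2 - 8 * (q\<^sup>2)\<^sup>2" by (simp add: power2_eq_square algebra_simps)
          also have "\<dots> \<le> 16 * q\<^sup>2" using zero_le_power2[of "q\<^sup>2"] zero_le_power2[of q] by linarith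
          also have "\<dots> = (4 * q)\<^sup>2" by (simp add: power_mult_distrib)
          finally show "2 - 2 * (1 - 2 * q\<^sup>2)\<^sup>2 \<le> (4 * q)\<^sup>2" .
        qed (use q in auto)
        also have "\<dots> = smin / 2" using lam0 by (simp add: q_def)
        finally show ?thesis .
      qed
      show "0 < d" "0 \<le> q / sqrt (real d)" using d q by auto
      show "Measurable.pred (entry_space n) (\<lambda>h. \<eta> (mat n n h) i)" if "i < d" for i
      proof -
        have [measurable]: "(\<lambda>h. est (mat n n h) \<bullet> e (r + 1 + i)) \<in> borel_measurable (entry_space n)"
          "(\<lambda>h. est (mat n n h) \<bullet> e l) \<in> borel_measurable (entry_space n)"
          using coord[of "r + 1 + i"] coord[OF ln] that d(1) by simp_all
        show ?thesis unfolding \<eta>_def by measurable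
      qed
      show "ennreal (q / sqrt (real d) * real (card {i\<in>{..<d}. \<eta> X i \<noteq> (i \<in> S)}))
          \<le> ennreal (min_pm_vec (est X) (nth_eigenvector l (A S)))" if X: "X \<in> carrier_mat n n" for S X
      proof -
        have y: "est X \<in> carrier_vec n" using est X by (simp add: vec_estimators_def)
        have "q / sqrt (real d) * real (card {i\<in>{..<d}. \<eta> X i \<noteq> (i \<in> S)}) \<le> min_pm_vec (est X) (basis_comb n e (f S))"
          unfolding \<eta>_def
          by (rule hypercube_loss[OF e(1) y S(1,2) d(1) fS(1) c(1) _ _ fS(2) d(2)]) (use dq c q in auto)
        also have "\<dots> = min_pm_vec (est X) (nth_eigenvector l (A S))"
          using ev[of S] y by (auto simp: min_pm_vec_uminus_right[of _ n])
        finally show ?thesis by (rule ennreal_leI)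
      qed
    qed
    also have "\<dots> \<le> (SUP A\<in>M2 c4 n r lam u l smin. vec_risk n sd l est A)"
      unfolding vec_risk_def using mem by (intro SUP_least SUP_upper2[OF mem]) auto
    finally show ?thesis .
  qed
  moreover have "1 / 64 * (smin * sqrt (real n) / \<bar>lam l\<bar>) \<le> q / sqrt (real d) * real d / 4"
  proof -
    have "sqrt (real n) \<le> 2 * sqrt (real d)"
    proof (rule real_le_lsqrt)
      show "real n \<le> (2 * sqrt (real d))\<^sup>2" using d by (simp add: power_mult_distrib)
    qed auto
    then have "1 / 64 * (smin / \<bar>lam l\<bar> * sqrt (real n)) \<le> 1 / 64 * (smin / \<bar>lam l\<bar> * (2 * sqrt (real d)))"
      using smin by (intro mult_left_mono) auto
    also have "\<dots> = q * (real d / sqrt (real d)) / 4" using d(2) by (simp add: real_div_sqrt q_def)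
    finally show ?thesis by simp
  qed
  ultimately show ?thesis unfolding vec_minimax_def
    by (intro INF_greatest) (meson ennreal_leI order_trans)
qed

section \<open>The lower bounds\<close>

theorem theorem3:
  shows
  "(\<exists>c0>0. \<exists>c1>0. \<forall>n r l lam u sd smin a.
      setting n r l lam u sd smin \<longrightarrow> a \<in> carrier_vec n \<longrightarrow>
        vec_minimax n sd l (M0 n r lam u smin)
          \<ge> ennreal c0 * (ennreal smin / eigengap r lam l) \<and>
        lin_minimax n sd l a (M0 n r lam u smin)
          \<ge> ennreal c1 *
             (ennreal \<bar>a \<bullet> u l\<bar> * ((ennreal smin)\<^sup>2 / (eigengap r lam l)\<^sup>2) +
              ennreal smin *
                (SUP k\<in>{1..r} - {l}. ennreal \<bar>a \<bullet> u k\<bar> / ennreal \<bar>lam l - lam k\<bar>)))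
   \<and>
   (\<exists>c2>0. \<forall>n r l lam u sd smin a.
      setting n r l lam u sd smin \<longrightarrow> a \<in> carrier_vec n \<longrightarrow>
        lin_minimax n sd l a (M1 n r lam u l smin)
          \<ge> ennreal (c2 * (smin * norm2 (a - (a \<bullet> u l) \<cdot>\<^sub>v u l) / \<bar>lam l\<bar>)))
   \<and>
   (\<exists>C>0. \<forall>c4\<ge>C. \<exists>c3>0. \<forall>n r l lam u sd smin.
      setting n r l lam u sd smin \<longrightarrow>
        vec_minimax n sd l (M2 c4 n r lam u l smin)
          \<ge> ennreal (c3 * (smin * sqrt (real n) / \<bar>lam l\<bar>)))"
proof (intro conjI)
  show "\<exists>c0>0. \<exists>c1>0. \<forall>n r l lam u sd smin a.
      setting n r l lam u sd smin \<longrightarrow> a \<in> carrier_vec n \<longrightarrow>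
        vec_minimax n sd l (M0 n r lam u smin)
          \<ge> ennreal c0 * (ennreal smin / eigengap r lam l) \<and>
        lin_minimax n sd l a (M0 n r lam u smin)
          \<ge> ennreal c1 *
             (ennreal \<bar>a \<bullet> u l\<bar> * ((ennreal smin)\<^sup>2 / (eigengap r lam l)\<^sup>2) +
              ennreal smin *
                (SUP k\<in>{1..r} - {l}. ennreal \<bar>a \<bullet> u k\<bar> / ennreal \<bar>lam l - lam k\<bar>))"
    by (rule exI[of _ "1 / 32"], intro conjI, simp, rule exI[of _ "1 / 1024"]) (use minimax_M0 in auto)
  show "\<exists>c2>0. \<forall>n r l lam u sd smin a.
      setting n r l lam u sd smin \<longrightarrow> a \<in> carrier_vec n \<longrightarrow>
        lin_minimax n sd l a (M1 n r lam u l smin)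
          \<ge> ennreal (c2 * (smin * norm2 (a - (a \<bullet> u l) \<cdot>\<^sub>v u l) / \<bar>lam l\<bar>))"
    by (rule exI[of _ "1 / 64"]) (use lin_minimax_M1 in auto)
  show "\<exists>C>0. \<forall>c4\<ge>C. \<exists>c3>0. \<forall>n r l lam u sd smin.
      setting n r l lam u sd smin \<longrightarrow>
        vec_minimax n sd l (M2 c4 n r lam u l smin)
          \<ge> ennreal (c3 * (smin * sqrt (real n) / \<bar>lam l\<bar>))"
    by (rule exI[of _ 1], intro conjI allI impI, simp, rule exI[of _ "1 / 64"]) (use vec_minimax_M2 in auto)
qed

end
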